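(* Let $q$ be a prime power and $\varepsilon\in\{-1,+1\}$. Then, as formal power series in $x$, $$1+\sum_{n\geq1}\Big[\sum_{\lambda\vdash n}\prod_{d\in B(\lambda)}\sum_{1\leq i\leq E(\lambda,d)}2^i\binom{E(\lambda,d)-1}{\varepsilon(E(\lambda,d)-i)}\binom{\mathrm{SDIM}^-_d(q)}{\varepsilon i}\Big]x^n=\Big(\frac{(1+x)(1+qx)}{(1-x)(1-qx)}\Big)^{\varepsilon}$$ and $$1+\sum_{n\geq1}\Big[\sum_{\lambda\vdash n}\prod_{d\in B(\lambda)}\sum_{1\leq i\leq E(\lambda,d)}2^i\binom{E(\lambda,d)-1}{\varepsilon(E(\lambda,d)-i)}\binom{\mathrm{SRIM}^-_d(q)}{\varepsilon i}\Big]x^n=\begin{cases}\big(\frac{1-x}{1-qx}\big)^{\varepsilon} & q\text{ odd}\\ \big(\frac{1}{1-qx}\big)^{\varepsilon} & q\text{ even.}\end{cases}$$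
   Context: For a monic $f(x)=\sum_{i=0}^d a_ix^i\in\mathbf{F}_{q^2}[x]$ of degree $d$ with $a_0\neq0$, its dual is $\tilde f(x)=\bar a_0^{-1}x^d\bar f(x^{-1})$ where $\bar f$ applies $a\mapsto a^q$ to coefficients; $f$ is self-dual if $\tilde f=f$. $\mathrm{SDIM}^-_d(q)$ is the number of self-dual irreducible monic polynomials of degree $d$ over $\mathbf{F}_{q^2}$. For $f\in\mathbf{F}_q[x]$ of degree $k$ with $f(0)\neq0$, $f$ is self-reciprocal if $x^kf(x^{-1})=f(x)$; $\mathrm{SRIM}^-_d(q)$ is the number of self-reciprocal irreducible monic polynomials of degree $2d$ over $\mathbf{F}_q$. For a partition $\lambda$, $B(\lambda)$ is its set of distinct parts and $E(\lambda,d)$ the multiplicity of $d$. For $m\in\mathbf{Q}$ and $k\geq0$, $\binom{m}{k}=m(m-1)\cdots(m-k+1)/k!$ and $\binom{m}{-k}=(-1)^k\binom{m}{k}$. *)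

theory Defs
  imports
    "HOL-Computational_Algebra.Computational_Algebra"
    "HOL-Number_Theory.Prime_Powers"
    "HOL-Library.Multiset"
    "HOL-Library.Cardinality"
begin

text \<open>
  The conjugation \<open>a \<mapsto> a\<^sup>q\<close> is the involution of a field with \<open>q\<^sup>2\<close> elements.
  For a polynomial \<open>g\<close> of degree \<open>d\<close>, \<open>reflect_poly g\<close> is \<open>x\<^sup>d g(x\<^sup>-\<^sup>1)\<close>.
\<close>

definition conj_poly :: "nat \<Rightarrow> 'a::field poly \<Rightarrow> 'a poly" where
  "conj_poly q f = map_poly (\<lambda>a. a ^ q) f"

definition dual_poly :: "nat \<Rightarrow> 'a::field poly \<Rightarrow> 'a poly" where
  "dual_poly q f = smult (inverse (coeff f 0 ^ q)) (reflect_poly (conj_poly q f))"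

definition self_dual :: "nat \<Rightarrow> 'a::field poly \<Rightarrow> bool" where
  "self_dual q f \<longleftrightarrow> lead_coeff f = 1 \<and> coeff f 0 \<noteq> 0 \<and> dual_poly q f = f"

definition self_reciprocal :: "'a::field poly \<Rightarrow> bool" where
  "self_reciprocal f \<longleftrightarrow> coeff f 0 \<noteq> 0 \<and> reflect_poly f = f"

text \<open>
  The coefficient field is passed as a type: \<open>SDIM_minus TYPE('K) q d\<close> is the intended number
  when \<open>'K\<close> has \<open>q\<^sup>2\<close> elements, and \<open>SRIM_minus TYPE('k) d\<close> is the intended number for
  \<open>q = CARD('k)\<close>; note that the latter counts polynomials of degree \<open>2 * d\<close>.
\<close>

definition SDIM_minus :: "'K::finite_field itself \<Rightarrow> nat \<Rightarrow> nat \<Rightarrow> nat" where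
  "SDIM_minus _ q d =
     card {f :: 'K poly. lead_coeff f = 1 \<and> degree f = d \<and> irreducible f \<and> self_dual q f}"

definition SRIM_minus :: "'k::finite_field itself \<Rightarrow> nat \<Rightarrow> nat" where
  "SRIM_minus _ d =
     card {f :: 'k poly. lead_coeff f = 1 \<and> degree f = 2 * d \<and> irreducible f \<and> self_reciprocal f}"

text \<open>
  A partition is the multiset of its parts; its set of distinct parts is \<open>set_mset\<close> and the
  multiplicity of a part is \<open>count\<close>.
\<close>

definition partitions :: "nat \<Rightarrow> nat multiset set" where
  "partitions n = {p. (\<forall>d\<in>#p. d > 0) \<and> sum_mset p = n}"

definition distinct_parts :: "nat multiset \<Rightarrow> nat set" where
  "distinct_parts p = set_mset p"

definition part_mult :: "nat multiset \<Rightarrow> nat \<Rightarrow> nat" where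
  "part_mult p d = count p d"

text \<open>
  For negative lower index this is the nonstandard convention
  \<open>binom(m, -k) = (-1)\<^sup>k binom(m, k)\<close>, not the usual value \<open>0\<close>.
\<close>

definition sbinom :: "rat \<Rightarrow> int \<Rightarrow> rat" where
  "sbinom m k =
     (if k \<ge> 0 then m gchoose (nat k) else (-1) ^ nat (-k) * (m gchoose (nat (-k))))"

end

(*
  Let \<sigma> be the duality involution on monic polynomials with nonzero constant term over a finite
  field, T(x) the series counting all such polynomials by degree, S(x) the one counting the
  \<sigma>-fixed ones, and N_d the number of \<sigma>-fixed irreducibles of degree d.  Unique factorization turns
  T(x^2) and S(x) into Euler products, and comparing them one \<sigma>-orbit of irreducibles at a time gives
    T(x^2) * prod_d ((1 + x^d) / (1 - x^d))^(N_d) = S(x)^2.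
  Both T and S are computed by counting coefficient lists, so no field extensions are needed.  The
  partition sum is a coefficient of prod_d ((1 + x^d) / (1 - x^d))^(\<epsilon> N_d), because
  (1 + x) / (1 - x) = 1 + 2 x / (1 - x).  For self-reciprocal polynomials \<sigma> also fixes x - 1 and
  x + 1, which are the only fixed irreducibles of odd degree; once their factor is split off, every
  series is one in x^2.
*)
theory Submission
  imports Defs
begin

section \<open>Weighted multisets and products of power series\<close>

text \<open>Every product is kept finite: irreducibles or parts are cut off at size
  \<open>m\<close>, and identities are read off in coefficients up to \<open>m\<close> only. Hence
  the lemmas on cancelling and inverting series that agree up to a given degree. The x^2 in T is
  forced by the orbits. A pair {p, \<sigma> p} of degree d each contributes (1 - x^(2d))^(-2) to
  T(x^2); its total degree is 2d, so it contributes the same to S^2. A fixed p contributes 1/(1 -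
  x^(2d)) to T(x^2) but (1 - x^d)^(-2) to S^2, and the quotient is exactly (1 + x^d)/(1 - x^d). For
  \<epsilon> = -1 the sign convention for binomials replaces x^d by -x^d in each factor separately,
  which inverts the factor. Both involutions come from one construction: conjugation by a^q over q^2
  elements, and the trivial conjugation over q elements. In the trivial case the normalised dual
  admits the constant term -1 besides 1; in odd characteristic x - 1 is the only fixed irreducible
  that has it.\<close>

definition weighted_msets :: "'a set \<Rightarrow> ('a \<Rightarrow> nat) \<Rightarrow> nat \<Rightarrow> 'a multiset set" where
  "weighted_msets A wt n = {M. set_mset M \<subseteq> A \<and> (\<Sum>a\<in>#M. wt a) = n}"

text \<open>Splitting off the copies of \<open>a\<close> makes a multiset a pair of a multiplicity
  and a multiset over \<open>A\<close>. This is the induction step both for finiteness and for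
  expanding a product factor by factor.\<close>

lemma weighted_msets_insert:
  assumes "a \<notin> A"
  shows "weighted_msets (insert a A) wt n =
           (\<lambda>(k, M). M + replicate_mset k a) `
             (SIGMA k:{k. k * wt a \<le> n}. weighted_msets A wt (n - k * wt a))"
    and "inj_on (\<lambda>(k, M). M + replicate_mset k a)
           (SIGMA k:{k. k * wt a \<le> n}. weighted_msets A wt (n - k * wt a))"
proof -
  show "weighted_msets (insert a A) wt n =
           (\<lambda>(k, M). M + replicate_mset k a) `
             (SIGMA k:{k. k * wt a \<le> n}. weighted_msets A wt (n - k * wt a))" (is "?L = ?R")
  proof
    show "?R \<subseteq> ?L"
      by (auto simp: weighted_msets_def split: if_splits)
    show "?L \<subseteq> ?R"
    proof
      fix M assume M: "M \<in> ?L"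
      define M' where "M' = filter_mset (\<lambda>x. x \<noteq> a) M"
      have eq: "M = M' + replicate_mset (count M a) a"
        by (rule multiset_eqI) (simp add: M'_def)
      have "(\<Sum>a\<in>#M. wt a) = (\<Sum>a\<in>#M'. wt a) + count M a * wt a"
        by (subst eq) simp
      with M have "(count M a, M') \<in>
          (SIGMA k:{k. k * wt a \<le> n}. weighted_msets A wt (n - k * wt a))"
        by (auto simp: weighted_msets_def M'_def)
      with eq show "M \<in> ?R" by force
    qed
  qed
  show "inj_on (\<lambda>(k, M). M + replicate_mset k a)
           (SIGMA k:{k. k * wt a \<le> n}. weighted_msets A wt (n - k * wt a))"
  proof (rule inj_onI, clarify)
    fix k M k' M'
    assume M: "M \<in> weighted_msets A wt (n - k * wt a)"
      and M': "M' \<in> weighted_msets A wt (n - k' * wt a)"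
      and eq: "M + replicate_mset k a = M' + replicate_mset k' a"
    have "count M a = 0" "count M' a = 0"
      using M M' assms by (auto simp: weighted_msets_def count_eq_zero_iff)
    with arg_cong[OF eq, of "\<lambda>N. count N a"] have "k = k'" by simp
    with eq show "k = k' \<and> M = M'" by simp
  qed
qed

lemma finite_weighted_msets:
  assumes "finite A" "\<And>a. a \<in> A \<Longrightarrow> wt a > 0"
  shows "finite (weighted_msets A wt n)"
  using assms
proof (induction A arbitrary: n rule: finite_induct)
  case empty
  show ?case by (simp add: weighted_msets_def)
next
  case (insert a A)
  have "finite {k. k * wt a \<le> n}"
  proof (rule finite_subset)
    show "{k. k * wt a \<le> n} \<subseteq> {..n}"
      using insert.prems[of a] by (auto intro: order.trans[rotated])
  qed simp
  with insert show ?case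
    by (auto simp: weighted_msets_insert)
qed

lemma compose_X_power_nth:
  fixes F :: "'b::comm_ring_1 fps"
  assumes "d > 0"
  shows "(F oo fps_X ^ d) $ n = (if d dvd n then F $ (n div d) else 0)"
proof -
  have "(F oo fps_X ^ d) $ n = (\<Sum>i=0..n. if n = d * i then F $ i else 0)"
    by (auto simp: fps_compose_nth simp flip: power_mult intro!: sum.cong)
  also have "\<dots> = (if d dvd n then F $ (n div d) else 0)"
  proof (cases "d dvd n")
    case True
    then obtain k where k: "n = d * k" ..
    have "(\<Sum>i=0..n. if n = d * i then F $ i else 0) = (\<Sum>i=0..n. if i = k then F $ i else 0)"
      using assms k by (intro sum.cong) auto
    also have "\<dots> = F $ k" using assms k by simp
    finally show ?thesis using k assms by simp
  qed (auto intro!: sum.neutral)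
  finally show ?thesis .
qed

text \<open>Choosing one term from each factor amounts to choosing a multiplicity for each element,
  that is, a weighted multiset. Since the constant coefficients are 1, elements of multiplicity 0
  drop out and only \<open>set_mset M\<close> remains. With all coefficients 1 this counts
  multisets; with the local factors it gives the sum over partitions.\<close>

lemma prod_compose_X_power_nth:
  fixes F :: "'a \<Rightarrow> 'b::comm_ring_1 fps"
  assumes "finite A" "\<And>a. a \<in> A \<Longrightarrow> wt a > 0" "\<And>a. a \<in> A \<Longrightarrow> F a $ 0 = 1"
  shows "(\<Prod>a\<in>A. F a oo fps_X ^ wt a) $ n =
           (\<Sum>M\<in>weighted_msets A wt n. \<Prod>a\<in>set_mset M. F a $ count M a)"
  using assms
proof (induction A arbitrary: n rule: finite_induct)
  case empty
  have "weighted_msets {} wt n = (if n = 0 then {{#}} else {})"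
    by (auto simp: weighted_msets_def)
  then show ?case by simp
next
  case (insert a A)
  define w where "w = wt a"
  have w: "w > 0" using insert.prems by (simp add: w_def)
  define S where "S = (SIGMA k:{k. k * w \<le> n}. weighted_msets A wt (n - k * w))"
  define c where "c M = (\<Prod>b\<in>set_mset M. F b $ count M b)" for M
  have fin: "finite {k. k * w \<le> n}"
  proof (rule finite_subset)
    show "{k. k * w \<le> n} \<subseteq> {..n}"
      using w by (auto intro: order.trans[rotated])
  qed simp
  have c: "c (M + replicate_mset k a) = F a $ k * c M" if "set_mset M \<subseteq> A" for k M
  proof (cases "k = 0")
    case False
    have a: "a \<notin># M" using that insert.hyps by auto
    then have "c (M + replicate_mset k a) = F a $ k * (\<Prod>b\<in>set_mset M. F b $ count (M + replicate_mset k a) b)"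
      using False by (simp add: c_def not_in_iff)
    also have "(\<Prod>b\<in>set_mset M. F b $ count (M + replicate_mset k a) b) = c M"
      unfolding c_def using a by (intro prod.cong) auto
    finally show ?thesis .
  qed (use insert.prems in simp)
  have "(\<Sum>M\<in>weighted_msets (insert a A) wt n. c M) = (\<Sum>(k, M)\<in>S. c (M + replicate_mset k a))"
    unfolding S_def w_def weighted_msets_insert(1)[OF insert.hyps(2)]
    by (subst sum.reindex[OF weighted_msets_insert(2)[OF insert.hyps(2)]])
       (simp add: case_prod_unfold o_def)
  also have "\<dots> = (\<Sum>(k, M)\<in>S. F a $ k * c M)"
    by (intro sum.cong refl) (auto simp: S_def weighted_msets_def c)
  also have "\<dots> = (\<Sum>k\<in>{k. k * w \<le> n}. F a $ k * (\<Sum>M\<in>weighted_msets A wt (n - k * w). c M))"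
    unfolding S_def using insert fin
    by (subst sum.Sigma [symmetric]) (auto simp: finite_weighted_msets sum_distrib_left)
  also have "\<dots> = (\<Sum>k\<in>{k. k * w \<le> n}. F a $ k * (\<Prod>a\<in>A. F a oo fps_X ^ wt a) $ (n - k * w))"
    using insert by (simp add: c_def)
  also have "\<dots> = (\<Sum>i\<in>(\<lambda>k. k * w) ` {k. k * w \<le> n}.
                     (F a oo fps_X ^ w) $ i * (\<Prod>a\<in>A. F a oo fps_X ^ wt a) $ (n - i))"
    using w by (subst sum.reindex) (auto intro!: inj_onI simp: compose_X_power_nth)
  also have "\<dots> = (\<Sum>i=0..n. (F a oo fps_X ^ w) $ i * (\<Prod>a\<in>A. F a oo fps_X ^ wt a) $ (n - i))"
  proof (intro sum.mono_neutral_left ballI)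
    fix i assume i: "i \<in> {0..n} - (\<lambda>k. k * w) ` {k. k * w \<le> n}"
    have "\<not> w dvd i"
    proof
      assume "w dvd i"
      then have "i = (i div w) * w" by simp
      with i show False by auto
    qed
    then show "(F a oo fps_X ^ w) $ i * (\<Prod>a\<in>A. F a oo fps_X ^ wt a) $ (n - i) = 0"
      using w by (simp add: compose_X_power_nth)
  qed auto
  also have "\<dots> = (\<Prod>a\<in>insert a A. F a oo fps_X ^ wt a) $ n"
    using insert.hyps by (simp add: fps_mult_nth w_def)
  finally show ?case by (simp add: c_def)
qed

lemma inverse_one_minus_X: "inverse (1 - fps_X :: 'a::field fps) = Abs_fps (\<lambda>_. 1)"
  by (metis fps_inverse_gp' fps_inverse_idempotent fps_nth_Abs_fps zero_neq_one)

lemma compose_inverse_one_minus_X: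
  assumes "d > 0"
  shows "(Abs_fps (\<lambda>_. 1) :: 'a::field fps) oo fps_X ^ d = inverse (1 - fps_X ^ d)"
  using assms
  by (simp flip: inverse_one_minus_X
      add: fps_inverse_compose fps_compose_sub_distrib)

lemma card_weighted_msets:
  assumes "finite A" "\<And>a. a \<in> A \<Longrightarrow> wt a > 0"
  shows "Abs_fps (\<lambda>n. of_nat (card (weighted_msets A wt n))) =
           (\<Prod>a\<in>A. inverse (1 - fps_X ^ wt a :: 'a::field fps))"
proof (rule fps_ext)
  fix n
  have "(\<Prod>a\<in>A. inverse (1 - fps_X ^ wt a :: 'a fps)) = (\<Prod>a\<in>A. Abs_fps (\<lambda>_. 1) oo fps_X ^ wt a)"
    using assms by (intro prod.cong) (auto simp: compose_inverse_one_minus_X)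
  then show "Abs_fps (\<lambda>n. of_nat (card (weighted_msets A wt n))) $ n =
           (\<Prod>a\<in>A. inverse (1 - fps_X ^ wt a :: 'a fps)) $ n"
    using assms by (simp add: prod_compose_X_power_nth)
qed

section \<open>Euler products over the orbits of an involution\<close>

text \<open>An invariant multiset has equal multiplicities at \<open>p\<close> and
  \<open>\<sigma> p\<close>, so it is in exactly one way a sum of orbits. Orbits are sets, so
  \<open>mset_set\<close> counts a fixed point once, and a fixed point weighs \<open>wt p\<close>
  while a proper pair weighs both its elements.\<close>

lemma weighted_msets_orbits:
  assumes fin: "finite P" and closed: "\<And>p. p \<in> P \<Longrightarrow> \<sigma> p \<in> P"
    and invol: "\<And>p. p \<in> P \<Longrightarrow> \<sigma> (\<sigma> p) = p"
  defines "Orb \<equiv> (\<lambda>p. {p, \<sigma> p}) ` P"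
  shows "bij_betw (\<lambda>N. \<Sum>x\<in>#N. mset_set x) (weighted_msets Orb (sum wt) n)
           {M \<in> weighted_msets P wt n. image_mset \<sigma> M = M}"
proof -
  define flat where "flat = (\<lambda>N :: 'a set multiset. \<Sum>x\<in>#N. mset_set x)"
  have flat_simps [simp]: "flat {#} = {#}" "flat (add_mset x N) = mset_set x + flat N" for x N
    by (simp_all add: flat_def)
  have orb_mem: "p \<in> x \<longleftrightarrow> x = {p, \<sigma> p}" if "p \<in> P" "x \<in> Orb" for p x
    using that invol by (auto simp: Orb_def)
  have fin_orb: "finite x" if "x \<in> Orb" for x
    using that by (auto simp: Orb_def)
  have orb_sub: "x \<subseteq> P" if "x \<in> Orb" for x
    using that closed by (auto simp: Orb_def)
  have orb_image: "image_mset \<sigma> (mset_set x) = mset_set x" if "x \<in> Orb" for x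
  proof -
    have "inj_on \<sigma> x" using orb_sub[OF that] invol by (metis inj_on_def subsetD)
    moreover have "\<sigma> ` x = x" using that invol by (auto simp: Orb_def)
    ultimately show ?thesis by (simp add: image_mset_mset_set)
  qed
  \<comment> \<open>The multiplicity of an orbit can be read off at any of its points, which gives
    injectivity.\<close>
  have count_flat: "count (flat N) p = count N {p, \<sigma> p}"
    if "set_mset N \<subseteq> Orb" "p \<in> P" for N p
    using that(1)
  proof (induction N)
    case (add x N)
    then show ?case using orb_mem[of p x] that(2) fin_orb[of x] by (auto simp: count_mset_set')
  qed simp
  have flat_props: "set_mset (flat N) \<subseteq> P \<and> (\<Sum>a\<in>#flat N. wt a) = (\<Sum>x\<in>#N. sum wt x)
      \<and> image_mset \<sigma> (flat N) = flat N" if "set_mset N \<subseteq> Orb" for N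
    using that
  proof (induction N)
    case (add x N)
    then show ?case using orb_sub[of x] fin_orb[of x] orb_image[of x]
      by (auto simp: sum_unfold_sum_mset)
  qed simp
  have inj: "inj_on flat (weighted_msets Orb (sum wt) n)"
  proof (rule inj_onI, rule multiset_eqI)
    fix N N' x
    assume N: "N \<in> weighted_msets Orb (sum wt) n" and N': "N' \<in> weighted_msets Orb (sum wt) n"
      and eq: "flat N = flat N'"
    show "count N x = count N' x"
    proof (cases "x \<in> Orb")
      case True
      then obtain p where "p \<in> P" "x = {p, \<sigma> p}" by (auto simp: Orb_def)
      with N N' eq count_flat[of N p] count_flat[of N' p] show ?thesis
        by (simp add: weighted_msets_def)
    next
      case False
      with N N' have "x \<notin># N" "x \<notin># N'" by (auto simp: weighted_msets_def)
      then show ?thesis by (simp add: not_in_iff)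
    qed
  qed
  have surj: "\<exists>N. set_mset N \<subseteq> Orb \<and> flat N = M"
    if "set_mset M \<subseteq> P" "image_mset \<sigma> M = M" for M
    using that
  proof (induction "size M" arbitrary: M rule: less_induct)
    case less
    show ?case
    proof (cases "M = {#}")
      case True
      then show ?thesis by (intro exI[of _ "{#}"]) simp
    next
      case False
      then obtain p where p: "p \<in># M" by blast
      then have "\<sigma> p \<in># image_mset \<sigma> M" by auto
      then have p': "\<sigma> p \<in># M" using less.prems(2) by simp
      define x where "x = {p, \<sigma> p}"
      have x: "x \<in> Orb" using p less.prems by (auto simp: x_def Orb_def)
      \<comment> \<open>Each element of \<open>x\<close> occurs once in \<open>mset_set x\<close>,
        so membership of \<open>p\<close> and \<open>\<sigma> p\<close> suffices even if they
        coincide; removing this orbit is the descent.\<close>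
      have sub: "mset_set x \<subseteq># M"
        using p p' by (simp add: subseteq_mset_def x_def count_mset_set')
      have "size (M - mset_set x) < size M"
        using sub p by (simp add: size_Diff_submset x_def) (metis False card_gt_0_iff diff_less
          finite.emptyI finite_insert insert_not_empty nonempty_has_size)
      moreover have "image_mset \<sigma> (M - mset_set x) = M - mset_set x"
        using sub less.prems(2) orb_image[OF x] by (simp add: image_mset_Diff)
      moreover have "set_mset (M - mset_set x) \<subseteq> P"
        using less.prems(1) by (meson in_diffD subset_iff)
      ultimately obtain N where "set_mset N \<subseteq> Orb" "flat N = M - mset_set x"
        using less.hyps by metis
      with x sub show ?thesis by (intro exI[of _ "add_mset x N"]) simp
    qed
  qed
  have "flat ` weighted_msets Orb (sum wt) n = {M \<in> weighted_msets P wt n. image_mset \<sigma> M = M}"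
  proof (intro equalityI subsetI)
    fix M assume "M \<in> flat ` weighted_msets Orb (sum wt) n"
    then show "M \<in> {M \<in> weighted_msets P wt n. image_mset \<sigma> M = M}"
      using flat_props by (auto simp: weighted_msets_def)
  next
    fix M assume M: "M \<in> {M \<in> weighted_msets P wt n. image_mset \<sigma> M = M}"
    then obtain N where "set_mset N \<subseteq> Orb" "flat N = M"
      using surj[of M] by (auto simp: weighted_msets_def)
    with M flat_props[of N] show "M \<in> flat ` weighted_msets Orb (sum wt) n"
      by (auto simp: weighted_msets_def)
  qed
  with inj show ?thesis by (simp add: bij_betw_def flat_def)
qed

text \<open>Each side is a product over the orbits of \<open>\<sigma>\<close>, and the factors agree orbit by orbit.\<close>

lemma orbit_euler_product:
  fixes wt :: "'a \<Rightarrow> nat"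
  assumes fin: "finite P" and closed: "\<And>p. p \<in> P \<Longrightarrow> \<sigma> p \<in> P"
    and invol: "\<And>p. p \<in> P \<Longrightarrow> \<sigma> (\<sigma> p) = p"
    and wt: "\<And>p. p \<in> P \<Longrightarrow> wt (\<sigma> p) = wt p" and pos: "\<And>p. p \<in> P \<Longrightarrow> wt p > 0"
  shows "(Abs_fps (\<lambda>n. of_nat (card (weighted_msets P wt n))) oo fps_X ^ 2) *
           (\<Prod>p\<in>{p \<in> P. \<sigma> p = p}. (1 + fps_X ^ wt p) * inverse (1 - fps_X ^ wt p)) =
         (Abs_fps (\<lambda>n. of_nat (card {M \<in> weighted_msets P wt n. image_mset \<sigma> M = M}))
           :: 'b::field fps) ^ 2"
proof -
  define Orb where "Orb = (\<lambda>p. {p, \<sigma> p}) ` P"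
  define g :: "'a \<Rightarrow> 'b fps" where "g p = (1 + fps_X ^ wt p) * inverse (1 - fps_X ^ wt p)" for p
  define h :: "'a \<Rightarrow> 'b fps"
    where "h p = inverse (1 - fps_X ^ (2 * wt p)) * (if \<sigma> p = p then g p else 1)" for p
  have fin_orb: "finite x" if "x \<in> Orb" for x
    using that by (auto simp: Orb_def)
  have P_eq: "P = \<Union>Orb" using closed by (auto simp: Orb_def)
  have "x = {p, \<sigma> p}" if "x \<in> Orb" "p \<in> x" for p x
    using that invol by (auto simp: Orb_def)
  then have disj: "x \<inter> y = {}" if "x \<in> Orb" "y \<in> Orb" "x \<noteq> y" for x y
    using that by blast
  have "(Abs_fps (\<lambda>n. of_nat (card (weighted_msets P wt n))) oo fps_X ^ 2 :: 'b fps) =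
          (\<Prod>p\<in>P. inverse (1 - fps_X ^ wt p) oo fps_X ^ 2)"
    using fin pos by (simp add: card_weighted_msets fps_compose_prod_distrib)
  also have "\<dots> = (\<Prod>p\<in>P. inverse (1 - fps_X ^ (2 * wt p)))"
  proof (intro prod.cong refl)
    fix p assume "p \<in> P"
    then show "inverse (1 - fps_X ^ wt p) oo fps_X ^ 2 = (inverse (1 - fps_X ^ (2 * wt p)) :: 'b fps)"
      using pos[of p] by (simp add: fps_inverse_compose fps_compose_sub_distrib
          fps_X_power_compose power_mult)
  qed
  finally have T: "(Abs_fps (\<lambda>n. of_nat (card (weighted_msets P wt n))) oo fps_X ^ 2 :: 'b fps) =
      (\<Prod>p\<in>P. inverse (1 - fps_X ^ (2 * wt p)))" .
  have "(\<Prod>p\<in>{p \<in> P. \<sigma> p = p}. g p) = (\<Prod>p\<in>P. if \<sigma> p = p then g p else 1)"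
    using fin by (simp add: prod.inter_filter)
  with T have "(Abs_fps (\<lambda>n. of_nat (card (weighted_msets P wt n))) oo fps_X ^ 2 :: 'b fps) *
      (\<Prod>p\<in>{p \<in> P. \<sigma> p = p}. g p) = (\<Prod>p\<in>P. h p)"
    by (simp add: h_def prod.distrib)
  also have "\<dots> = (\<Prod>x\<in>Orb. \<Prod>p\<in>x. h p)"
    unfolding P_eq using fin_orb disj by (subst prod.Union_disjoint) auto
  also have "\<dots> = (\<Prod>x\<in>Orb. inverse (1 - fps_X ^ sum wt x) ^ 2)"
  proof (intro prod.cong refl)
    fix x assume "x \<in> Orb"
    then obtain p where p: "p \<in> P" "x = {p, \<sigma> p}" by (auto simp: Orb_def)
    show "(\<Prod>p\<in>x. h p) = inverse (1 - fps_X ^ sum wt x) ^ 2"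
    proof (cases "\<sigma> p = p")
      \<comment> \<open>With w = x^(wt p), the fixed-point factor is (1 + w) / ((1 - w^2) (1 - w)) =
        1 / (1 - w)^2.\<close>
      case True
      let ?w = "fps_X ^ wt p :: 'b fps"
      have "inverse (1 + ?w) * (1 + ?w) = 1"
        using pos[OF p(1)] by (intro inverse_mult_eq_1) simp
      moreover have "1 - fps_X ^ (2 * wt p) = (1 - ?w) * (1 + ?w)"
        by (simp add: algebra_simps power_mult power2_eq_square flip: power_mult_distrib)
      then have "h p = (inverse (1 + ?w) * (1 + ?w)) * (inverse (1 - ?w) * inverse (1 - ?w))"
        by (simp only: h_def g_def fps_inverse_mult True simp_thms if_True mult_ac)
      ultimately have "h p = inverse (1 - ?w) * inverse (1 - ?w)"
        by (simp only: mult_1_left)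
      with p True show ?thesis by (simp add: power2_eq_square)
    next
      \<comment> \<open>Two distinct points contribute 1 / (1 - x^(2 wt p)) each, and
        \<open>sum wt x\<close> is twice \<open>wt p\<close>.\<close>
      case False
      then show ?thesis using p invol[OF p(1)] wt[OF p(1)]
        by (simp add: h_def power2_eq_square mult_2)
    qed
  qed
  also have "\<dots> = (\<Prod>x\<in>Orb. inverse (1 - fps_X ^ sum wt x)) ^ 2"
    by (simp add: prod_power_distrib)
  also have "(\<Prod>x\<in>Orb. inverse (1 - fps_X ^ sum wt x)) =
      (Abs_fps (\<lambda>n. of_nat (card (weighted_msets Orb (sum wt) n))) :: 'b fps)"
  proof (rule card_weighted_msets [symmetric])
    fix x assume "x \<in> Orb"
    then obtain p where "p \<in> P" "x = {p, \<sigma> p}" by (auto simp: Orb_def)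
    with pos[of p] show "sum wt x > 0" by (intro sum_pos2[of _ p]) auto
  qed (simp add: Orb_def fin)
  also have "\<dots> = Abs_fps (\<lambda>n. of_nat (card {M \<in> weighted_msets P wt n. image_mset \<sigma> M = M}))"
    unfolding Orb_def
    using bij_betw_same_card[OF weighted_msets_orbits[of P \<sigma> wt], OF fin closed invol]
    by simp
  finally show ?thesis unfolding g_def .
qed

section \<open>The partition series\<close>

text \<open>The coefficient counts compositions of n + 1 into i + 1 positive parts. For Y = X / (1 -
  X) the relation Y = X + X Y turns into Pascal's rule for the coefficients of the powers of
  Y.\<close>

lemma X_over_one_minus_X_power_nth:
  "((fps_X * inverse (1 - fps_X)) ^ Suc i :: 'a::field fps) $ Suc n = of_nat (n choose i)"
proof -
  define Y :: "'a fps" where "Y = fps_X * inverse (1 - fps_X)"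
  have "Y * (1 - fps_X) = fps_X"
    using inverse_mult_eq_1[of "1 - fps_X :: 'a fps"] by (simp add: Y_def mult.assoc)
  then have "Y ^ i * Y * (1 - fps_X) = Y ^ i * fps_X" for i
    by (simp only: mult.assoc)
  then have "(Y ^ Suc i - fps_X * Y ^ Suc i) $ Suc n = (fps_X * Y ^ i) $ Suc n" for i n
    by (simp only: right_diff_distrib mult_1_right power_Suc2 mult.commute[of fps_X])
  then have step: "Y ^ Suc i $ Suc n = Y ^ Suc i $ n + Y ^ i $ n" for i n
    by (simp del: power_Suc add: algebra_simps)
  have "Y ^ Suc i $ Suc n = of_nat (n choose i)"
  proof (induction n arbitrary: i)
    case 0
    show ?case by (simp add: step del: power_Suc) (cases i; simp add: Y_def)
  next
    case (Suc n)
    show ?case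
      using Suc[of 0] by (subst step) (cases i; simp add: Suc del: power_Suc)
  qed
  then show ?thesis by (simp add: Y_def)
qed

text \<open>Expand (1 + 2 Y)^N with Y = X / (1 - X). The coefficient of X^n in Y^i is n - 1 over i -
  1, rewritten by symmetry as n - 1 over n - i to match the summand of the partition sum.\<close>

lemma one_plus_X_over_one_minus_X_power_nth:
  assumes "n > 0"
  shows "((1 + fps_X) * inverse (1 - fps_X) :: 'a::field fps) ^ N $ n =
           (\<Sum>i=1..n. 2 ^ i * of_nat ((n - 1) choose (n - i)) * of_nat (N choose i))"
proof -
  define Y :: "'a fps" where "Y = fps_X * inverse (1 - fps_X)"
  have "inverse (1 - fps_X) * (1 - fps_X) = (1 :: 'a fps)"
    by (intro inverse_mult_eq_1) simp
  then have "inverse (1 - fps_X) - Y = (1 :: 'a fps)"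
    by (simp only: right_diff_distrib mult_1_right Y_def mult.commute[of fps_X])
  then have "inverse (1 - fps_X) = Y + (1 :: 'a fps)"
    by (simp only: diff_eq_eq add.commute)
  moreover have "(1 + fps_X) * inverse (1 - fps_X) = inverse (1 - fps_X) + Y"
    by (simp only: distrib_right mult_1_left Y_def)
  ultimately have "(1 + fps_X) * inverse (1 - fps_X) = 2 * Y + 1"
    by (simp only: mult_2 add_ac)
  then have "((1 + fps_X) * inverse (1 - fps_X) :: 'a fps) ^ N = (2 * Y + 1) ^ N"
    by (rule arg_cong)
  also have "\<dots> = (\<Sum>i\<le>N. of_nat (N choose i) * (2 * Y) ^ i)"
    by (simp add: binomial_ring)
  finally have "((1 + fps_X) * inverse (1 - fps_X) :: 'a fps) ^ N $ n =
      (\<Sum>i\<le>N. of_nat (N choose i) * (2 * Y) ^ i) $ n"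
    by (rule arg_cong)
  also have "\<dots> = (\<Sum>i\<le>N. of_nat (N choose i) * (2 ^ i * Y ^ i $ n))"
  proof -
    have "(of_nat k * (2 * Y) ^ i) $ n = of_nat k * (2 ^ i * Y ^ i $ n)" for k i
    proof -
      have "of_nat k * (2 * Y) ^ i = fps_const (of_nat k * 2 ^ i) * Y ^ i"
        by (simp add: power_mult_distrib fps_of_nat mult.assoc numeral_fps_const
            flip: fps_const_mult fps_const_power)
      then show ?thesis by (simp only: fps_mult_left_const_nth mult.assoc)
    qed
    then show ?thesis by (simp only: fps_sum_nth)
  qed
  \<comment> \<open>The union of both ranges allows each to be trimmed for its own reason: the
    binomial vanishes for i > N, and the coefficient of Y^i vanishes for i = 0 and for i >
    n.\<close>
  also have "\<dots> = (\<Sum>i\<in>{1..n} \<union> {..N}. of_nat (N choose i) * (2 ^ i * Y ^ i $ n))"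
    by (intro sum.mono_neutral_left) (auto simp: binomial_eq_0)
  also have "\<dots> = (\<Sum>i=1..n. of_nat (N choose i) * (2 ^ i * Y ^ i $ n))"
  proof (intro sum.mono_neutral_right ballI)
    fix i assume i: "i \<in> {1..n} \<union> {..N} - {1..n}"
    have "Y ^ i $ n = 0"
    proof (cases i)
      case 0
      then show ?thesis using assms by simp
    next
      case (Suc j)
      with i assms obtain k where "n = Suc k" "k < j" by (cases n) auto
      with Suc show ?thesis
        using X_over_one_minus_X_power_nth[of j k, where 'a = 'a]
        by (simp only: Y_def binomial_eq_0 of_nat_0)
    qed
    then show "of_nat (N choose i) * (2 ^ i * Y ^ i $ n) = 0" by simp
  qed auto
  also have "\<dots> = (\<Sum>i=1..n. 2 ^ i * of_nat ((n - 1) choose (n - i)) * of_nat (N choose i))"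
  proof (intro sum.cong refl)
    fix i assume i: "i \<in> {1..n}"
    then obtain j k where jk: "i = Suc j" "n = Suc k" "j \<le> k" by (cases i; cases n) auto
    then have "Y ^ i $ n = of_nat (k choose j)"
      using X_over_one_minus_X_power_nth[of j k, where 'a = 'a] by (simp only: Y_def)
    with jk show "of_nat (N choose i) * (2 ^ i * Y ^ i $ n) =
        2 ^ i * of_nat ((n - 1) choose (n - i)) * of_nat (N choose i)"
      using binomial_symmetric[of j k] by (simp del: power_Suc)
  qed
  finally show ?thesis .
qed

lemma sbinom_of_nat:
  assumes "\<epsilon> \<in> {-1, 1}"
  shows "sbinom (of_nat n) (\<epsilon> * int k) = of_int \<epsilon> ^ k * of_nat (n choose k)"
  using assms by (cases "k = 0") (auto simp: sbinom_def simp flip: binomial_gbinomial)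

text \<open>Both left-hand sides of the theorem are instances, with the counting function of the
  irreducibles as \<open>N\<close>.\<close>

definition partition_series :: "int \<Rightarrow> (nat \<Rightarrow> nat) \<Rightarrow> rat fps" where
  "partition_series \<epsilon> N = Abs_fps (\<lambda>n. if n = 0 then 1 else
     (\<Sum>p\<in>partitions n. \<Prod>d\<in>distinct_parts p. \<Sum>i=1..part_mult p d.
        2 ^ i * sbinom (of_nat (part_mult p d) - 1) (\<epsilon> * (int (part_mult p d) - int i))
              * sbinom (of_nat (N d)) (\<epsilon> * int i)))"

text \<open>The two signed binomials contribute \<epsilon>^(n - i) and \<epsilon>^i. Their product
  \<epsilon>^n does not depend on i, so the convention for negative lower indices amounts to
  substituting \<epsilon> X for X.\<close>

lemma local_factor_nth:
  assumes "\<epsilon> \<in> {-1, 1}" "n > 0"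
  shows "(\<Sum>i=1..n. 2 ^ i * sbinom (of_nat n - 1) (\<epsilon> * (int n - int i))
                          * sbinom (of_nat N) (\<epsilon> * int i)) =
         (((1 + fps_X) * inverse (1 - fps_X)) ^ N oo fps_const (of_int \<epsilon>) * fps_X) $ n"
proof -
  have "2 ^ i * sbinom (of_nat n - 1) (\<epsilon> * (int n - int i)) * sbinom (of_nat N) (\<epsilon> * int i) =
        of_int \<epsilon> ^ n * (2 ^ i * of_nat ((n - 1) choose (n - i)) * of_nat (N choose i))"
    if "i \<in> {1..n}" for i
  proof -
    have "(of_nat n - 1 :: rat) = of_nat (n - 1)" "int n - int i = int (n - i)"
      using that by (auto simp: of_nat_diff)
    moreover have "(of_int \<epsilon> :: rat) ^ n = of_int \<epsilon> ^ (n - i) * of_int \<epsilon> ^ i"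
      using that by (simp flip: power_add)
    ultimately show ?thesis by (simp only: sbinom_of_nat[OF assms(1)] mult_ac)
  qed
  then have "(\<Sum>i=1..n. 2 ^ i * sbinom (of_nat n - 1) (\<epsilon> * (int n - int i))
                          * sbinom (of_nat N) (\<epsilon> * int i)) =
      of_int \<epsilon> ^ n * (\<Sum>i=1..n. 2 ^ i * of_nat ((n - 1) choose (n - i)) * of_nat (N choose i))"
    unfolding sum_distrib_left by (rule sum.cong[OF refl])
  then show ?thesis
    by (simp only: one_plus_X_over_one_minus_X_power_nth[OF assms(2)] fps_nth_compose_linear)
qed

lemma partition_series_nth:
  assumes \<epsilon>: "\<epsilon> \<in> {-1, 1}" and "n \<le> m"
  shows "partition_series \<epsilon> N $ n =
    (\<Prod>d=1..m. (((1 + fps_X) * inverse (1 - fps_X)) ^ N d oo fps_const (of_int \<epsilon>) * fps_X) oo fps_X ^ d) $ n"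
proof -
  define F :: "nat \<Rightarrow> rat fps"
    where "F d = (((1 + fps_X) * inverse (1 - fps_X)) ^ N d oo fps_const (of_int \<epsilon>) * fps_X)" for d
  \<comment> \<open>No part of a partition of n exceeds n, so cutting the parts off at m loses
    nothing.\<close>
  have part: "partitions n = weighted_msets {1..m} (\<lambda>d. d) n"
  proof -
    have "d \<le> n" if "d \<in># p" "sum_mset p = n" for d p
      using that by (metis sum_mset.remove le_add1)
    then show ?thesis
      using assms(2) by (fastforce simp: partitions_def weighted_msets_def)
  qed
  have "(\<Prod>d=1..m. F d oo fps_X ^ d) $ n =
      (\<Sum>p\<in>partitions n. \<Prod>d\<in>set_mset p. F d $ count p d)"
    unfolding part by (intro prod_compose_X_power_nth) (auto simp: F_def fps_nth_power_0)
  also have "\<dots> = partition_series \<epsilon> N $ n"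
  proof (cases "n = 0")
    case True
    have "p = {#}" if "\<forall>d\<in>#p. d > 0" "sum_mset p = 0" for p :: "nat multiset"
      using that by (metis multiset_nonemptyE not_gr0 sum_mset_0_iff)
    then have "partitions 0 = {{#}}" by (auto simp: partitions_def)
    with True show ?thesis by (simp add: partition_series_def)
  next
    case False
    have "F d $ count p d = (\<Sum>i=1..part_mult p d.
        2 ^ i * sbinom (of_nat (part_mult p d) - 1) (\<epsilon> * (int (part_mult p d) - int i))
              * sbinom (of_nat (N d)) (\<epsilon> * int i))" if "d \<in># p" for p d
      unfolding F_def part_mult_def
      by (rule local_factor_nth [OF \<epsilon>, symmetric]) (use that in simp)
    with False show ?thesis
      by (simp add: partition_series_def distinct_parts_def)
  qed
  finally show ?thesis by (simp add: F_def)
qed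

text \<open>Follows from 1/f - 1/g = (g - f) / (f g). A truncated product agrees with its limit only
  up to some degree, so the case \<epsilon> = -1 needs inversion in this local form.\<close>

lemma fps_inverse_nth_cong:
  fixes f g :: "'a::field fps"
  assumes "\<And>i. i \<le> n \<Longrightarrow> f $ i = g $ i" "f $ 0 \<noteq> 0"
  shows "inverse f $ n = inverse g $ n"
proof -
  have "g $ 0 \<noteq> 0" using assms by auto
  have "(g - f) * (inverse f * inverse g) =
      (inverse g * g) * inverse f - (inverse f * f) * inverse g"
    unfolding left_diff_distrib by (simp only: mult_ac)
  with \<open>g $ 0 \<noteq> 0\<close> have "inverse f - inverse g = (g - f) * (inverse f * inverse g)"
    using inverse_mult_eq_1[of f] inverse_mult_eq_1[of g] assms(2) by simp
  also have "\<dots> $ n = 0"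
    using assms(1) by (simp add: fps_mult_nth)
  finally show ?thesis by simp
qed

text \<open>Reduces both signs to a single statement about truncated Euler products in which
  \<epsilon> no longer occurs.\<close>

lemma partition_series_eqI:
  fixes Q :: "rat fps"
  assumes \<epsilon>: "\<epsilon> \<in> {-1, 1}"
    and Q: "\<And>m n. n \<le> m \<Longrightarrow>
      (\<Prod>d=1..m. ((1 + fps_X ^ d) * inverse (1 - fps_X ^ d)) ^ N d) $ n = Q $ n"
  shows "partition_series \<epsilon> N = Q powi \<epsilon>"
proof (rule fps_ext)
  fix n
  define H :: "nat \<Rightarrow> rat fps" where "H d = ((1 + fps_X ^ d) * inverse (1 - fps_X ^ d)) ^ N d" for d
  define G :: "rat fps" where "G = (1 + fps_X) * inverse (1 - fps_X)"
  have H: "G ^ N d oo fps_X ^ d = H d" if "d > 0" for d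
    using that by (simp add: H_def G_def fps_compose_power [symmetric] fps_compose_mult_distrib
        fps_compose_add_distrib fps_compose_sub_distrib fps_inverse_compose)
  \<comment> \<open>Replacing X by -X exchanges numerator and denominator; substituting X^d
    afterwards yields the sign change of x^d, even when d is even.\<close>
  have "G oo - fps_X = inverse G"
    by (simp add: G_def fps_compose_mult_distrib fps_compose_add_distrib
        fps_compose_sub_distrib fps_inverse_compose fps_inverse_mult)
  then have H': "(G ^ N d oo - fps_X) oo fps_X ^ d = inverse (H d)" if "d > 0" for d
    using that by (simp add: fps_compose_power [symmetric] fps_inverse_power G_def fps_inverse_compose flip: H)
  from \<epsilon> consider "\<epsilon> = 1" | "\<epsilon> = -1" by auto
  then show "partition_series \<epsilon> N $ n = (Q powi \<epsilon>) $ n"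
  proof cases
    case 1
    then have "partition_series \<epsilon> N $ n = (\<Prod>d=1..n. G ^ N d oo fps_X ^ d) $ n"
      using partition_series_nth[OF \<epsilon>, of n n N] by (simp add: G_def)
    also have "\<dots> = (\<Prod>d=1..n. H d) $ n"
      using H by simp
    finally show ?thesis using Q[of n n] 1 by (simp add: H_def)
  next
    case 2
    have "partition_series \<epsilon> N $ n = (\<Prod>d=1..n. (G ^ N d oo - fps_X) oo fps_X ^ d) $ n"
      using partition_series_nth[OF \<epsilon>, of n n N] 2
      by (simp add: G_def fps_const_neg[symmetric] del: fps_const_neg)
    also have "\<dots> = (\<Prod>d=1..n. inverse (H d)) $ n"
      using H' by simp
    also have "(\<Prod>d=1..n. inverse (H d)) = inverse (\<Prod>d=1..n. H d)"
      by (induction n) (simp_all add: fps_inverse_mult)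
    also have "\<dots> $ n = inverse Q $ n"
    proof (rule fps_inverse_nth_cong)
      show "(\<Prod>d=1..n. H d) $ i = Q $ i" if "i \<le> n" for i
        using Q[OF that] by (simp add: H_def)
      have "(\<Prod>d=1..k. H d) $ 0 = 1" for k
        by (induction k) (simp_all add: H_def fps_nth_power_0)
      then show "(\<Prod>d=1..n. H d) $ 0 \<noteq> 0" by simp
    qed
    finally show ?thesis using 2 by (simp add: power_int_def)
  qed
qed

section \<open>Monic polynomials and duality\<close>

text \<open>Requiring a nonzero constant term excludes the prime x. Reversal then preserves degrees,
  which makes duality an involution.\<close>

definition monics :: "nat \<Rightarrow> 'a::field poly set" where
  "monics n = {f. lead_coeff f = 1 \<and> coeff f 0 \<noteq> 0 \<and> degree f = n}"

definition irred_monics :: "'a::field poly set" where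
  "irred_monics = {p. irreducible p \<and> lead_coeff p = 1 \<and> coeff p 0 \<noteq> 0}"

lemma irreducible_degree_pos: "irreducible p \<Longrightarrow> degree p > 0" for p :: "'a::field poly"
  by (cases "p = 0") (auto simp: irreducible_def is_unit_iff_degree intro!: Nat.gr0I)

lemma irred_monicsD:
  assumes "p \<in> irred_monics"
  shows "irreducible p" "lead_coeff p = 1" "coeff p 0 \<noteq> 0" "p \<noteq> 0" "degree p > 0"
  using assms irreducible_degree_pos[of p] by (auto simp: irred_monics_def)

lemma monic_factorization_exists:
  fixes f :: "'a::field poly"
  assumes "lead_coeff f = 1" "coeff f 0 \<noteq> 0"
  shows "\<exists>M. set_mset M \<subseteq> irred_monics \<and> prod_mset M = f"
  using assms
proof (induction "degree f" arbitrary: f rule: less_induct)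
  case less
  have f0: "f \<noteq> 0" using less.prems by auto
  show ?case
  proof (cases "degree f = 0")
    case True
    then have "f = 1" using less.prems by (metis degree_0_id lead_coeff_1 one_pCons)
    then show ?thesis by (intro exI[of _ "{#}"]) simp
  next
    case False
    then have nu: "\<not> is_unit f" using f0 by (simp add: is_unit_iff_degree)
    show ?thesis
    proof (cases "irreducible f")
      case True
      then show ?thesis using less.prems by (intro exI[of _ "{#f#}"]) (simp add: irred_monics_def)
    next
      case False
      then obtain g h where gh: "f = g * h" "\<not> is_unit g" "\<not> is_unit h"
        using f0 nu by (auto simp: irreducible_def)
      have gh0: "g \<noteq> 0" "h \<noteq> 0" using gh f0 by auto
      \<comment> \<open>Moving the leading coefficient of \<open>g\<close> over to \<open>h\<close>
        makes both factors monic without changing the product.\<close>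
      define a where "a = lead_coeff g"
      define g' h' where "g' = smult (inverse a) g" and "h' = smult a h"
      have a0: "a \<noteq> 0" using gh0 by (simp add: a_def)
      have f_eq: "f = g' * h'" using a0 gh by (simp add: g'_def h'_def)
      have "lead_coeff g' = 1" using a0 by (simp add: g'_def a_def)
      moreover from this f_eq less.prems have "lead_coeff h' = 1" by (simp add: lead_coeff_mult)
      moreover have "coeff g' 0 \<noteq> 0" "coeff h' 0 \<noteq> 0"
        using f_eq less.prems by (auto simp: coeff_mult_0)
      moreover have "degree g' < degree f" "degree h' < degree f"
        using gh gh0 a0 by (auto simp: g'_def h'_def degree_mult_eq is_unit_iff_degree)
      ultimately obtain A B where "set_mset A \<subseteq> irred_monics" "prod_mset A = g'"
        "set_mset B \<subseteq> irred_monics" "prod_mset B = h'"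
        using less.hyps by metis
      then show ?thesis using f_eq by (intro exI[of _ "A + B"]) auto
    qed
  qed
qed

lemma monic_irreducible_dvd_imp_eq:
  fixes p r :: "'a::field poly"
  assumes "p \<in> irred_monics" "r \<in> irred_monics" "p dvd r"
  shows "p = r"
proof -
  obtain c where c: "r = p * c" using assms(3) ..
  have "is_unit c"
    using irreducibleD[OF irred_monicsD(1)[OF assms(2)] c] irred_monicsD(1)[OF assms(1)]
    by (auto simp: irreducible_def)
  moreover have "c \<noteq> 0" using c irred_monicsD(4)[OF assms(2)] by auto
  ultimately have "degree c = 0" by (simp add: is_unit_iff_degree)
  moreover have "lead_coeff c = 1"
    using c irred_monicsD(2)[OF assms(1)] irred_monicsD(2)[OF assms(2)] by (simp add: lead_coeff_mult)
  ultimately have "c = 1" by (metis degree_0_id one_pCons)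
  with c show ?thesis by simp
qed

text \<open>Irreducible polynomials over a field are prime, and monic associates are equal. So
  factorizations agree as multisets, not merely up to units.\<close>

lemma monic_factorization_unique:
  fixes A B :: "'a::field poly multiset"
  assumes "set_mset A \<subseteq> irred_monics" "set_mset B \<subseteq> irred_monics" "prod_mset A = prod_mset B"
  shows "A = B"
  using assms
proof (induction A arbitrary: B)
  case empty
  show ?case
  proof (rule ccontr)
    assume "{#} \<noteq> B"
    then obtain b where b: "b \<in># B" by (metis multiset_nonemptyE)
    then have "b dvd 1" using empty.prems(3) by (metis dvd_prod_mset prod_mset_empty)
    moreover have "irreducible b" using b empty.prems(2) irred_monicsD(1) by blast
    ultimately show False by (simp add: irreducible_def)
  qed
next
  case (add p A)
  have p: "p \<in> irred_monics" using add.prems by simp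
  have "prime_elem p" using irred_monicsD(1)[OF p] by (rule field_poly_irreducible_imp_prime)
  moreover have "p dvd prod_mset B" by (simp flip: add.prems(3))
  ultimately obtain b where b: "b \<in># B" "p dvd b" by (rule prime_elem_dvd_prod_msetE) blast
  with add.prems p have "p = b" by (intro monic_irreducible_dvd_imp_eq) auto
  with b obtain B' where B': "B = add_mset p B'" by (metis mset_add)
  have "prod_mset A = prod_mset B'"
    using add.prems(3) irred_monicsD(4)[OF p] by (simp add: B')
  then have "A = B'" using add.prems B' by (intro add.IH) auto
  with B' show ?case by simp
qed

lemma prod_mset_irred_monics:
  fixes M :: "'a::field poly multiset"
  assumes "set_mset M \<subseteq> irred_monics"
  shows "prod_mset M \<in> monics (\<Sum>p\<in>#M. degree p)"
  using assms
proof (induction M)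
  case (add p M)
  then have p: "p \<in> irred_monics" and M: "prod_mset M \<in> monics (\<Sum>p\<in>#M. degree p)" by auto
  from M have "lead_coeff (prod_mset M) = 1" unfolding monics_def by blast
  then have nz: "prod_mset M \<noteq> 0" by (metis leading_coeff_0_iff zero_neq_one)
  have "lead_coeff (p * prod_mset M) = 1"
    using irred_monicsD(2)[OF p] \<open>lead_coeff (prod_mset M) = 1\<close> by (simp only: lead_coeff_mult mult_1)
  with M nz irred_monicsD[OF p] show ?case
    by (auto simp: monics_def degree_mult_eq coeff_mult_0)
qed (simp add: monics_def)

text \<open>A factor of a polynomial of degree n has degree at most n, so the bound m is harmless,
  and over a finite field it makes the set of available irreducibles finite.\<close>

lemma bij_betw_factorization:
  assumes "n \<le> m"
  shows "bij_betw prod_mset (weighted_msets {p \<in> irred_monics. degree p \<le> m} degree n)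
           (monics n :: 'a::field poly set)"
  unfolding bij_betw_def
proof
  show "inj_on prod_mset (weighted_msets {p \<in> irred_monics :: 'a poly set. degree p \<le> m} degree n)"
    by (rule inj_onI, rule monic_factorization_unique) (auto simp: weighted_msets_def)
  show "prod_mset ` weighted_msets {p \<in> irred_monics. degree p \<le> m} degree n =
      (monics n :: 'a poly set)"
  proof (intro equalityI subsetI)
    fix f :: "'a poly" assume "f \<in> monics n"
    then obtain M where M: "set_mset M \<subseteq> irred_monics" "prod_mset M = f" "degree f = n"
      using monic_factorization_exists[of f] by (auto simp: monics_def)
    have "(\<Sum>p\<in>#M. degree p) = n"
      using prod_mset_irred_monics[OF M(1)] M by (simp add: monics_def)
    moreover from this have "degree p \<le> n" if "p \<in># M" for p
      using that by (metis image_mset_add_mset le_add1 mset_add sum_mset.insert)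
    ultimately have "M \<in> weighted_msets {p \<in> irred_monics. degree p \<le> m} degree n"
      using M(1) assms by (auto simp: weighted_msets_def intro: order.trans)
    with M(2) show "f \<in> prod_mset ` weighted_msets {p \<in> irred_monics. degree p \<le> m} degree n"
      by blast
  next
    fix f :: "'a poly"
    assume "f \<in> prod_mset ` weighted_msets {p \<in> irred_monics. degree p \<le> m} degree n"
    then obtain M where "set_mset M \<subseteq> irred_monics" "(\<Sum>p\<in>#M. degree p) = n" "f = prod_mset M"
      by (auto simp: weighted_msets_def)
    then show "f \<in> monics n" using prod_mset_irred_monics[of M] by simp
  qed
qed

lemma finite_polys_degree_le: "finite {p :: 'a::{zero,finite} poly. degree p \<le> m}"
proof (rule finite_imageD)
  show "finite (coeffs ` {p :: 'a poly. degree p \<le> m})"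
  proof (rule finite_subset)
    show "coeffs ` {p :: 'a poly. degree p \<le> m} \<subseteq> {xs. set xs \<subseteq> UNIV \<and> length xs \<le> Suc m}"
      by (auto simp: degree_eq_length_coeffs)
  qed (rule finite_lists_length_le, simp)
qed (simp add: inj_on_def coeffs_eq_iff)

section \<open>Duality with respect to an involution of a finite field\<close>

locale field_involution =
  fixes \<phi> :: "'a::finite_field \<Rightarrow> 'a"
  assumes hom_add: "\<phi> (a + b) = \<phi> a + \<phi> b"
    and hom_mult: "\<phi> (a * b) = \<phi> a * \<phi> b"
    and invol [simp]: "\<phi> (\<phi> a) = a"
begin

lemma hom_0 [simp]: "\<phi> 0 = 0"
proof -
  have "\<phi> 0 + \<phi> 0 = \<phi> 0 + 0" by (simp flip: hom_add)
  then show ?thesis by (rule add_left_imp_eq)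
qed

lemma hom_eq_0_iff [simp]: "\<phi> a = 0 \<longleftrightarrow> a = 0"
  using invol[of a] by (auto simp del: invol)

lemma hom_1 [simp]: "\<phi> 1 = 1"
  using hom_mult[of "\<phi> 1" 1] by simp

lemma hom_inverse: "\<phi> (inverse a) = inverse (\<phi> a)"
proof (cases "a = 0")
  case False
  then have "\<phi> a * \<phi> (inverse a) = 1" by (simp flip: hom_mult)
  then show ?thesis by (metis inverse_unique)
qed simp

lemma hom_sum: "\<phi> (sum f A) = (\<Sum>x\<in>A. \<phi> (f x))"
  by (induction A rule: infinite_finite_induct) (simp_all add: hom_add)

lemma map_poly_hom_mult: "map_poly \<phi> (f * g) = map_poly \<phi> f * map_poly \<phi> g"
  by (rule poly_eqI) (simp add: coeff_map_poly coeff_mult hom_sum hom_mult)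

text \<open>Dividing by the conjugated constant term makes the dual monic. With
  \<open>\<phi> a = a ^ q\<close> this is \<open>dual_poly\<close>; with trivial
  \<open>\<phi>\<close> it differs from plain reversal by a scalar, a gap that has to be closed for
  self-reciprocal polynomials.\<close>

definition dual :: "'a poly \<Rightarrow> 'a poly" where
  "dual f = smult (inverse (\<phi> (coeff f 0))) (reflect_poly (map_poly \<phi> f))"

lemma degree_map_poly_hom [simp]: "degree (map_poly \<phi> f) = degree f"
  by (intro degree_map_poly) simp

lemma coeff_dual:
  "coeff (dual f) i =
     (if i > degree f then 0 else inverse (\<phi> (coeff f 0)) * \<phi> (coeff f (degree f - i)))"
  by (simp add: dual_def coeff_reflect_poly coeff_map_poly)

lemma degree_dual: "coeff f 0 \<noteq> 0 \<Longrightarrow> degree (dual f) = degree f"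
  by (simp add: dual_def coeff_map_poly)

text \<open>Conjugation, reversal and the constant term are all multiplicative. If a constant term
  vanishes, the default \<open>inverse 0 = 0\<close> makes both sides 0.\<close>

lemma dual_mult: "dual (f * g) = dual f * dual g"
  by (simp add: dual_def map_poly_hom_mult reflect_poly_mult coeff_mult_0 hom_mult mult_ac)

lemma dual_1 [simp]: "dual 1 = 1"
  by (simp add: dual_def)

lemma dual_prod_mset: "dual (prod_mset M) = prod_mset (image_mset dual M)"
  by (induction M) (simp_all add: dual_mult)

lemma dual_in_monics: "f \<in> monics n \<Longrightarrow> dual f \<in> monics n"
  by (auto simp: monics_def degree_dual coeff_dual)

lemma dual_dual: "f \<in> monics n \<Longrightarrow> dual (dual f) = f"
  by (rule poly_eqI)
     (auto simp: monics_def coeff_dual[of "dual f"] degree_dual coeff_dual[of f]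
        hom_mult hom_inverse coeff_eq_0)

text \<open>Duality carries a factorization of \<open>dual p\<close> back to one of
  \<open>p\<close>, and as it preserves degrees it preserves the distinction between units and
  non-units.\<close>

lemma dual_in_irred_monics:
  assumes "p \<in> irred_monics"
  shows "dual p \<in> irred_monics"
proof -
  note p = irred_monicsD[OF assms]
  have pm: "p \<in> monics (degree p)" using p by (simp add: monics_def)
  have dp: "dual p \<in> monics (degree p)" using dual_in_monics[OF pm] .
  have "irreducible (dual p)"
  proof (rule irreducibleI)
    show "dual p \<noteq> 0" using dp by (auto simp: monics_def)
    show "\<not> is_unit (dual p)" using dp p \<open>dual p \<noteq> 0\<close>
      by (simp add: monics_def is_unit_iff_degree)
    fix a b assume ab: "dual p = a * b"
    have nz: "coeff a 0 \<noteq> 0" "coeff b 0 \<noteq> 0"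
      using dp ab by (auto simp: monics_def coeff_mult_0)
    have "is_unit (dual c) \<longleftrightarrow> is_unit c" if "coeff c 0 \<noteq> 0" for c
    proof -
      have "c \<noteq> 0" "dual c \<noteq> 0" using that by (auto simp: dual_def map_poly_eq_0_iff)
      then show ?thesis using degree_dual[OF that] by (simp add: is_unit_iff_degree)
    qed
    moreover have "p = dual a * dual b"
      using dual_dual[OF pm] ab by (simp add: dual_mult)
    ultimately show "is_unit a \<or> is_unit b"
      using irreducibleD[OF p(1)] nz by blast
  qed
  with dp show ?thesis by (auto simp: irred_monics_def monics_def)
qed

definition fixed_irreds :: "nat \<Rightarrow> nat" where
  "fixed_irreds d = card {p \<in> irred_monics. degree p = d \<and> dual p = p}"

text \<open>The orbit identity holds exactly for the counts \<open>T'\<close> and \<open>S'\<close>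
  of products of irreducibles of degree at most \<open>m\<close>. These agree with the true counts
  up to degree \<open>m\<close>.\<close>

lemma euler_product_fixed_irreds:
  fixes S T :: "rat fps"
  defines "T \<equiv> Abs_fps (\<lambda>n. of_nat (card (monics n :: 'a poly set)))"
    and "S \<equiv> Abs_fps (\<lambda>n. of_nat (card {f \<in> monics n. dual f = f}))"
  assumes "n \<le> m"
  shows "((T oo fps_X ^ 2) *
           (\<Prod>d=1..m. ((1 + fps_X ^ d) * inverse (1 - fps_X ^ d)) ^ fixed_irreds d)) $ n = S\<^sup>2 $ n"
proof -
  define P where "P = {p \<in> (irred_monics :: 'a poly set). degree p \<le> m}"
  define g :: "nat \<Rightarrow> rat fps" where "g d = (1 + fps_X ^ d) * inverse (1 - fps_X ^ d)" for d
  define T' :: "rat fps" where "T' = Abs_fps (\<lambda>n. of_nat (card (weighted_msets P degree n)))"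
  define S' :: "rat fps"
    where "S' = Abs_fps (\<lambda>n. of_nat (card {M \<in> weighted_msets P degree n. image_mset dual M = M}))"
  have fin: "finite P"
    by (rule finite_subset[OF _ finite_polys_degree_le[of m]]) (auto simp: P_def)
  have prod: "(\<Prod>p\<in>{p \<in> P. dual p = p}. g (degree p)) = (\<Prod>d=1..m. g d ^ fixed_irreds d)"
  proof -
    have "(\<Prod>p\<in>{p \<in> P. dual p = p}. g (degree p)) =
        (\<Prod>d=1..m. \<Prod>p\<in>{p \<in> {p \<in> P. dual p = p}. degree p = d}. g (degree p))"
    proof (rule prod.group [symmetric])
      show "degree ` {p \<in> P. dual p = p} \<subseteq> {1..m}"
        by (auto simp: P_def Suc_le_eq dest: irred_monicsD(5))
    qed (simp_all add: fin)
    also have "\<dots> = (\<Prod>d=1..m. g d ^ fixed_irreds d)"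
    proof (intro prod.cong refl)
      fix d assume "d \<in> {1..m}"
      then have "{p \<in> {p \<in> P. dual p = p}. degree p = d} =
          {p \<in> irred_monics. degree p = d \<and> dual p = p}" by (auto simp: P_def)
      then show "(\<Prod>p\<in>{p \<in> {p \<in> P. dual p = p}. degree p = d}. g (degree p)) = g d ^ fixed_irreds d"
        by (simp add: fixed_irreds_def)
    qed
    finally show ?thesis .
  qed
  have "(T' oo fps_X ^ 2) * (\<Prod>p\<in>{p \<in> P. dual p = p}. g (degree p)) = S'\<^sup>2"
    unfolding T'_def S'_def g_def
  proof (rule orbit_euler_product[OF fin])
    fix p assume "p \<in> P"
    then have p: "p \<in> irred_monics" "degree p \<le> m" by (auto simp: P_def)
    then have pm: "p \<in> monics (degree p)" by (auto simp: irred_monics_def monics_def)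
    show "degree (dual p) = degree p" "degree p > 0"
      using irred_monicsD[OF p(1)] by (simp_all add: degree_dual)
    with p show "dual p \<in> P" by (simp add: P_def dual_in_irred_monics)
    show "dual (dual p) = p" using pm by (rule dual_dual)
  qed
  then have main: "(T' oo fps_X ^ 2) * (\<Prod>d=1..m. g d ^ fixed_irreds d) = S'\<^sup>2"
    using prod by simp
  have T_eq: "T $ i = T' $ i" if "i \<le> m" for i
    using bij_betw_same_card[OF bij_betw_factorization[OF that, where 'a = 'a]]
    by (simp add: T_def T'_def P_def)
  \<comment> \<open>By unique factorization a polynomial is self-dual exactly when duality permutes
    its multiset of irreducible factors.\<close>
  have S_eq: "S $ i = S' $ i" if le: "i \<le> m" for i
  proof -
    have "bij_betw prod_mset {M \<in> weighted_msets P degree i. image_mset dual M = M}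
            {f \<in> monics i. dual f = f}"
    proof (rule bij_betw_subset[OF bij_betw_factorization[OF le, where 'a = 'a], folded P_def])
      show "prod_mset ` {M \<in> weighted_msets P degree i. image_mset dual M = M} =
          {f \<in> monics i. dual f = f}"
      proof (intro equalityI subsetI)
        fix f assume f: "f \<in> {f \<in> monics i. dual f = f}"
        then obtain M where M: "M \<in> weighted_msets P degree i" "f = prod_mset M"
          using bij_betw_factorization[OF le, where 'a = 'a]
          unfolding bij_betw_def P_def by blast
        have "prod_mset (image_mset dual M) = prod_mset M"
          using f M by (simp add: dual_prod_mset)
        then have "image_mset dual M = M"
          using M(1) by (intro monic_factorization_unique)
            (auto simp: weighted_msets_def P_def intro: dual_in_irred_monics)
        with M show "f \<in> prod_mset ` {M \<in> weighted_msets P degree i. image_mset dual M = M}"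
          by blast
      next
        fix f assume "f \<in> prod_mset ` {M \<in> weighted_msets P degree i. image_mset dual M = M}"
        then obtain M where M: "M \<in> weighted_msets P degree i" "image_mset dual M = M"
          "f = prod_mset M" by blast
        then have "f \<in> monics i"
          using bij_betwE[OF bij_betw_factorization[OF le, where 'a = 'a]]
          unfolding P_def by blast
        with M show "f \<in> {f \<in> monics i. dual f = f}" by (simp add: dual_prod_mset)
      qed
    qed auto
    then show ?thesis by (simp add: S_def S'_def bij_betw_same_card)
  qed
  have "((T oo fps_X ^ 2) * (\<Prod>d=1..m. g d ^ fixed_irreds d)) $ n =
      ((T' oo fps_X ^ 2) * (\<Prod>d=1..m. g d ^ fixed_irreds d)) $ n"
    using \<open>n \<le> m\<close> by (auto simp: fps_mult_nth compose_X_power_nth T_eq intro!: sum.cong)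
  also have "\<dots> = S'\<^sup>2 $ n" by (simp only: main)
  also have "\<dots> = S\<^sup>2 $ n"
    using \<open>n \<le> m\<close> by (simp add: power2_eq_square fps_mult_nth S_eq)
  finally show ?thesis unfolding g_def .
qed

end

section \<open>Counting self-dual polynomials\<close>

text \<open>The first half of the list is free and determines the second; a middle entry, present in
  odd length, must be fixed by \<open>\<tau>\<close>. As \<open>\<tau>\<close> is an involution,
  mirrored positions impose one condition only.\<close>

lemma card_symmetric_lists:
  fixes \<tau> :: "'a::finite \<Rightarrow> 'a"
  assumes invol: "\<And>a. \<tau> (\<tau> a) = a"
  shows "card {xs. length xs = n \<and> map \<tau> (rev xs) = xs} =
           CARD('a) ^ (n div 2) * (if even n then 1 else card {a. \<tau> a = a})"
proof (induction n rule: induct_nat_012)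
  case 0
  have "{xs. length xs = 0 \<and> map \<tau> (rev xs) = xs} = {[]}" by auto
  then show ?case by simp
next
  case 1
  have "{xs. length xs = Suc 0 \<and> map \<tau> (rev xs) = xs} = (\<lambda>a. [a]) ` {a. \<tau> a = a}"
    by (auto simp: length_Suc_conv)
  then show ?case by (simp add: card_image inj_on_def)
next
  case (ge2 n)
  define S where "S k = {xs. length xs = k \<and> map \<tau> (rev xs) = xs}" for k
  have "S (Suc (Suc n)) = (\<lambda>(x, ys). x # ys @ [\<tau> x]) ` (UNIV \<times> S n)"
  proof (intro equalityI subsetI)
    fix xs assume xs: "xs \<in> S (Suc (Suc n))"
    then obtain x zs where "xs = x # zs" "length zs = Suc n"
      by (auto simp: S_def length_Suc_conv)
    moreover from this obtain ys y where "zs = ys @ [y]" "length ys = n"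
      by (metis length_Suc_conv_rev)
    ultimately have "xs = x # ys @ [y]" "length ys = n" by auto
    with xs have "xs = x # ys @ [\<tau> x]" "ys \<in> S n" by (auto simp: S_def invol)
    then show "xs \<in> (\<lambda>(x, ys). x # ys @ [\<tau> x]) ` (UNIV \<times> S n)" by auto
  qed (auto simp: S_def invol)
  moreover have "inj_on (\<lambda>(x, ys). x # ys @ [\<tau> x]) (UNIV \<times> S n)"
    by (auto simp: inj_on_def)
  ultimately have "card (S (Suc (Suc n))) = CARD('a) * card (S n)"
    by (simp add: card_image card_cartesian_product)
  with ge2 show ?case by (simp add: S_def)
qed

lemma coeffs_Poly_monic:
  fixes c :: "'a::field"
  shows "coeffs (Poly (c # xs @ [1])) = c # xs @ [1]"
proof -
  have "strip_while ((=) 0) ((c # xs) @ [1]) = (c # xs) @ [1]"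
    by (subst strip_while_snoc) simp
  then show ?thesis by (simp only: coeffs_Poly append_Cons)
qed

text \<open>The constant term is kept apart from the interior coefficients because it determines the
  twist in the symmetry that self-duality imposes on them.\<close>

lemma bij_betw_coeff_lists:
  "bij_betw (\<lambda>(c, xs). Poly (c # xs @ [1])) ({c :: 'a::field. c \<noteq> 0} \<times> {xs. length xs = n})
     (monics (Suc n))"
  unfolding bij_betw_def
proof
  show "inj_on (\<lambda>(c, xs). Poly (c # xs @ [1 :: 'a])) ({c. c \<noteq> 0} \<times> {xs. length xs = n})"
  proof (rule inj_onI, clarify)
    fix c d :: 'a and xs ys assume "Poly (c # xs @ [1]) = Poly (d # ys @ [1])"
    then have "coeffs (Poly (c # xs @ [1])) = coeffs (Poly (d # ys @ [1]))" by (rule arg_cong)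
    then show "c = d \<and> xs = ys" by (simp only: coeffs_Poly_monic) simp
  qed
  show "(\<lambda>(c, xs). Poly (c # xs @ [1 :: 'a])) ` ({c. c \<noteq> 0} \<times> {xs. length xs = n}) = monics (Suc n)"
  proof (intro equalityI subsetI)
    fix f assume "f \<in> (\<lambda>(c, xs). Poly (c # xs @ [1 :: 'a])) ` ({c. c \<noteq> 0} \<times> {xs. length xs = n})"
    then obtain c xs where f: "f = Poly (c # xs @ [1])" "c \<noteq> 0" "length xs = n" by auto
    then have cf: "coeffs f = c # xs @ [1]" by (simp only: coeffs_Poly_monic)
    then have "degree f = Suc n" using f by (simp add: degree_eq_length_coeffs)
    moreover have "f \<noteq> 0" using cf by auto
    then have "lead_coeff f = 1" using cf last_coeffs_eq_coeff_degree[of f] by simp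
    moreover have "coeff f 0 = c" using cf by (simp add: f(1))
    ultimately show "f \<in> monics (Suc n)" using f by (simp add: monics_def)
  next
    fix f :: "'a poly" assume f: "f \<in> monics (Suc n)"
    then have f': "lead_coeff f = 1" "coeff f 0 \<noteq> 0" "degree f = Suc n" "f \<noteq> 0"
      by (auto simp: monics_def)
    then have "length (coeffs f) = Suc (Suc n)" by (simp add: length_coeffs_degree)
    then obtain c zs where "coeffs f = c # zs" "length zs = Suc n"
      by (auto simp: length_Suc_conv)
    moreover from this obtain xs y where "zs = xs @ [y]" "length xs = n"
      by (metis length_Suc_conv_rev)
    ultimately have cf: "coeffs f = c # xs @ [y]" "length xs = n" by auto
    then have "y = 1" using f' last_coeffs_eq_coeff_degree[of f] by simp
    with cf have "f = Poly (c # xs @ [1])" by (metis Poly_coeffs)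
    moreover from this have "coeff f 0 = c" by simp
    ultimately show "f \<in> (\<lambda>(c, xs). Poly (c # xs @ [1 :: 'a])) ` ({c. c \<noteq> 0} \<times> {xs. length xs = n})"
      using f' cf by force
  qed
qed

lemma monics_0: "monics 0 = {1 :: 'a::field poly}"
  by (auto simp: monics_def elim: degree_eq_zeroE)

lemma card_monics:
  "card (monics n :: 'a::finite_field poly set) =
     (if n = 0 then 1 else (CARD('a) - 1) * CARD('a) ^ (n - 1))"
proof (cases n)
  case 0
  then show ?thesis by (simp add: monics_0)
next
  case (Suc k)
  have "card {xs :: 'a list. length xs = k} = CARD('a) ^ k"
    using card_lists_length_eq[of "UNIV :: 'a set" k] by simp
  moreover have "{c :: 'a. c \<noteq> 0} = UNIV - {0}" by auto
  then have "card {c :: 'a. c \<noteq> 0} = CARD('a) - 1" by (simp add: card_Diff_singleton)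
  ultimately show ?thesis
    using bij_betw_same_card[OF bij_betw_coeff_lists[of k, where 'a = 'a]] Suc
    by (simp add: card_cartesian_product)
qed

context field_involution
begin

text \<open>Comparing constant terms gives \<open>inverse (\<phi> c) = c\<close>, that is,
  \<open>c\<close> has norm 1. The scalar in the dual is then \<open>c\<close> itself, and the
  interior has to be symmetric under a twist by \<open>c\<close>.\<close>

lemma dual_Poly_eq_iff:
  assumes "c \<noteq> 0"
  shows "dual (Poly (c # xs @ [1])) = Poly (c # xs @ [1]) \<longleftrightarrow>
           c * \<phi> c = 1 \<and> map (\<lambda>a. c * \<phi> a) (rev xs) = xs"
proof -
  define f where "f = Poly (c # xs @ [1])"
  have cf: "coeffs f = c # xs @ [1]" unfolding f_def by (rule coeffs_Poly_monic)
  have c0: "coeff f 0 = c" by (simp add: f_def)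
  have "coeffs (map_poly \<phi> f) = map \<phi> (c # xs @ [1])"
    by (subst coeffs_map_poly') (simp_all add: cf)
  then have "coeffs (reflect_poly (map_poly \<phi> f)) = 1 # map \<phi> (rev xs) @ [\<phi> c]"
    using assms by (simp add: coeffs_reflect_poly rev_map)
  then have "coeffs (dual f) = map ((*) (inverse (\<phi> c))) (1 # map \<phi> (rev xs) @ [\<phi> c])"
    using assms by (simp add: dual_def c0 coeffs_smult)
  then have "coeffs (dual f) = inverse (\<phi> c) # map (\<lambda>a. inverse (\<phi> c) * \<phi> a) (rev xs) @ [1]"
    using assms by simp
  then have "dual f = f \<longleftrightarrow> inverse (\<phi> c) = c \<and> map (\<lambda>a. inverse (\<phi> c) * \<phi> a) (rev xs) = xs"
    by (simp add: coeffs_eq_iff cf)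
  moreover have "inverse (\<phi> c) = c \<longleftrightarrow> c * \<phi> c = 1"
    using assms by (auto simp: field_simps)
  ultimately show ?thesis unfolding f_def by auto
qed

lemma card_self_dual:
  "card {f \<in> monics (Suc n). dual f = f} =
     (\<Sum>c | c * \<phi> c = 1. CARD('a) ^ (n div 2) * (if even n then 1 else card {a. c * \<phi> a = a}))"
proof -
  define L where "L c = {xs. length xs = n \<and> map (\<lambda>a. c * \<phi> a) (rev xs) = xs}" for c
  have fin: "finite (L c)" for c
    by (rule finite_subset[OF _ finite_lists_length_eq[of "UNIV :: 'a set" n]]) (auto simp: L_def)
  have "bij_betw (\<lambda>(c, xs). Poly (c # xs @ [1])) (SIGMA c:{c. c * \<phi> c = 1}. L c)
          {f \<in> monics (Suc n). dual f = f}"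
  proof (rule bij_betw_subset[OF bij_betw_coeff_lists[of n]])
    show sub: "(SIGMA c:{c. c * \<phi> c = 1}. L c) \<subseteq> {c. c \<noteq> 0} \<times> {xs. length xs = n}"
      by (auto simp: L_def)
    show "(\<lambda>(c, xs). Poly (c # xs @ [1])) ` (SIGMA c:{c. c * \<phi> c = 1}. L c) =
        {f \<in> monics (Suc n). dual f = f}"
    proof (intro equalityI subsetI)
      fix f assume "f \<in> (\<lambda>(c, xs). Poly (c # xs @ [1])) ` (SIGMA c:{c. c * \<phi> c = 1}. L c)"
      then obtain c xs where f: "f = Poly (c # xs @ [1])" "(c, xs) \<in> (SIGMA c:{c. c * \<phi> c = 1}. L c)"
        by auto
      then have "c \<noteq> 0" "length xs = n" using sub by auto
      with f show "f \<in> {f \<in> monics (Suc n). dual f = f}"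
        using bij_betwE[OF bij_betw_coeff_lists[of n, where 'a = 'a]] dual_Poly_eq_iff[of c xs]
        by (auto simp: L_def)
    next
      fix f assume f: "f \<in> {f \<in> monics (Suc n). dual f = f}"
      have "f \<in> (\<lambda>(c, xs). Poly (c # xs @ [1])) ` ({c. c \<noteq> 0} \<times> {xs. length xs = n})"
        unfolding bij_betw_imp_surj_on[OF bij_betw_coeff_lists] using f by blast
      then obtain c xs where cx: "f = Poly (c # xs @ [1])" "c \<noteq> 0" "length xs = n" by auto
      with f dual_Poly_eq_iff[of c xs]
      have "(c, xs) \<in> (SIGMA c:{c. c * \<phi> c = 1}. L c)" by (simp add: L_def)
      with cx(1) show "f \<in> (\<lambda>(c, xs). Poly (c # xs @ [1])) ` (SIGMA c:{c. c * \<phi> c = 1}. L c)"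
        by (auto intro!: image_eqI[of _ _ "(c, xs)"])
    qed
  qed
  then have "card {f \<in> monics (Suc n). dual f = f} = (\<Sum>c | c * \<phi> c = 1. card (L c))"
    using fin by (simp add: bij_betw_same_card[symmetric] card_SigmaI)
  also have "\<dots> = (\<Sum>c | c * \<phi> c = 1.
      CARD('a) ^ (n div 2) * (if even n then 1 else card {a. c * \<phi> a = a}))"
  proof (intro sum.cong refl)
    fix c assume c: "c \<in> {c. c * \<phi> c = 1}"
    \<comment> \<open>The norm condition is just what makes the twisted map an involution, so that
      symmetric lists can be counted.\<close>
    have "c * \<phi> (c * \<phi> a) = a" for a
      using c by (simp add: hom_mult flip: mult.assoc)
    then show "card (L c) = CARD('a) ^ (n div 2) * (if even n then 1 else card {a. c * \<phi> a = a})"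
      unfolding L_def by (rule card_symmetric_lists)
  qed
  finally show ?thesis .
qed

end

text \<open>With Q elements in the field, x^k - d divides x^Q - x, which vanishes everywhere. The
  cofactor has degree Q - k and at most that many roots, so at least k roots are left for x^k -
  d.\<close>

lemma card_power_eq:
  fixes d :: "'a::finite_field"
  assumes km: "k * m = CARD('a) - 1" and "k > 0" "d ^ m = 1"
  shows "card {x. x ^ k = d} = k"
proof -
  let ?Q = "CARD('a)"
  \<comment> \<open>\<open>r\<close> is x times the geometric sum that turns x^k - d into (x^k)^m -
    d^m = x^(Q-1) - 1.\<close>
  define p r where "p = monom 1 k - [:d:]"
    and "r = [:0, 1:] * (\<Sum>i<m. monom 1 k ^ i * [:d:] ^ (m - Suc i))"
  have Q: "?Q > 1"
    using card_mono[of UNIV "{0, 1 :: 'a}"] by simp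
  have "p * r = [:0, 1:] * (monom 1 k ^ m - [:d:] ^ m)"
    unfolding p_def r_def power_diff_sumr2[of "monom 1 k"] by (simp only: mult_ac)
  also have "monom 1 k ^ m = (monom 1 (?Q - 1) :: 'a poly)"
    by (simp add: monom_power km mult.commute)
  also have "[:d:] ^ m = 1"
    using assms by (simp add: poly_const_pow)
  also have "[:0, 1:] * (monom 1 (?Q - 1) - 1) = monom 1 ?Q - monom (1 :: 'a) 1"
  proof -
    have X: "[:0, 1:] = monom (1 :: 'a) 1" by (simp add: monom_Suc monom_0)
    have "1 + (?Q - 1) = ?Q" using Q by simp
    then show ?thesis by (simp only: X right_diff_distrib mult_monom mult_1_right)
  qed
  finally have pr: "p * r = monom 1 ?Q - monom (1 :: 'a) 1" .
  have "degree (monom 1 ?Q - monom (1 :: 'a) 1) = ?Q"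
    using Q by (subst diff_conv_add_uminus, subst degree_add_eq_left) (simp_all add: degree_monom_eq)
  then have deg: "degree (p * r) = ?Q" by (simp add: pr)
  then have nz: "p \<noteq> 0" "r \<noteq> 0" using Q by auto
  have degp: "degree p = k"
    unfolding p_def using assms(2)
    by (subst diff_conv_add_uminus, subst degree_add_eq_left) (simp_all add: degree_monom_eq)
  have "poly (p * r) x = 0" for x
    by (simp add: pr poly_monom finite_field_power_card_eq_same)
  then have "UNIV = {x. poly p x = 0} \<union> {x. poly r x = 0}" by auto
  then have "?Q \<le> card {x. poly p x = 0} + card {x. poly r x = 0}"
    by (metis card_Un_le)
  also have "card {x. poly r x = 0} \<le> degree r"
    using nz by (intro card_poly_roots_bound)
  finally have "?Q \<le> card {x. poly p x = 0} + degree r" by simp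
  moreover have "?Q = k + degree r" using deg degp nz by (simp add: degree_mult_eq)
  moreover have "card {x. poly p x = 0} \<le> k"
    using card_poly_roots_bound[of p] nz degp by simp
  ultimately have "card {x. poly p x = 0} = k" by simp
  then show ?thesis by (simp add: p_def poly_monom)
qed

text \<open>Translation by 1 permutes the field, so comparing the sums of all elements shows that
  the number of elements is 0 in the field. The characteristic therefore divides a power of the
  prime under \<open>q\<close>. This makes a^q additive.\<close>

lemma finite_field_card_primepow:
  assumes "primepow q" "CARD('a::finite_field) = q ^ e"
  shows "\<exists>k. q = CHAR('a) ^ k"
proof -
  obtain p k where pk: "prime p" "q = p ^ k" using assms(1) by (auto simp: primepow_def)
  have "prime CHAR('a)" by simp
  moreover have "CHAR('a) dvd p ^ (k * e)"
  proof -
    have "(\<Sum>x\<in>UNIV. x) = (\<Sum>x\<in>UNIV. x + 1 :: 'a)"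
      by (rule sum.reindex_bij_witness[of _ "\<lambda>x. x + 1" "\<lambda>x. x - 1"]) auto
    then have "of_nat CARD('a) = (0 :: 'a)" by (simp add: sum.distrib)
    then have "CHAR('a) dvd CARD('a)" by (simp only: of_nat_eq_0_iff_char_dvd)
    then show ?thesis by (simp only: assms(2) pk(2) power_mult)
  qed
  ultimately have "CHAR('a) = p"
    using pk by (metis prime_dvd_power primes_dvd_imp_eq)
  with pk show ?thesis by blast
qed

section \<open>Closed forms of the counting series\<close>

lemma fps_mult_nth_cancel:
  fixes f g h :: "'a::field fps"
  assumes "f $ 0 \<noteq> 0" "\<And>i. i \<le> n \<Longrightarrow> (f * g) $ i = (f * h) $ i"
  shows "g $ n = h $ n"
proof -
  have cancel: "inverse f * (f * k) = k" for k
    using inverse_mult_eq_1[OF assms(1)] by (simp only: mult.assoc[symmetric] mult_1_left)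
  have "(inverse f * (f * g)) $ n = (inverse f * (f * h)) $ n"
    unfolding fps_mult_nth[of "inverse f"] by (intro sum.cong) (auto simp: assms(2))
  then show ?thesis by (simp only: cancel)
qed

text \<open>Covers the sequences 1, c, c a, c a^2, ... For all monic polynomials over Q elements a =
  Q and c = Q - 1; for the self-dual ones over q^2 elements a = q and c = q + 1.\<close>

lemma geometric_fps_mult:
  fixes a c :: "'a::comm_ring_1"
  shows "Abs_fps (\<lambda>n. if n = 0 then 1 else c * a ^ (n - 1)) * (1 - fps_const a * fps_X) =
           1 + fps_const (c - a) * fps_X"
proof (rule fps_ext)
  fix n
  define F where "F = Abs_fps (\<lambda>n. if n = 0 then 1 else c * a ^ (n - 1))"
  have "F * (1 - fps_const a * fps_X) = F - fps_const a * (fps_X * F)"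
    by (simp add: algebra_simps)
  then show "(F * (1 - fps_const a * fps_X)) $ n = (1 + fps_const (c - a) * fps_X) $ n"
    by (cases n; cases "n - 1") (auto simp: F_def algebra_simps)
qed

lemma monics_series:
  "Abs_fps (\<lambda>n. of_nat (card (monics n :: 'a::finite_field poly set))) *
     (1 - of_nat CARD('a) * fps_X) = (1 - fps_X :: rat fps)"
proof -
  have "CARD('a) > 0" by simp
  then have "Abs_fps (\<lambda>n. of_nat (card (monics n :: 'a poly set))) =
      (Abs_fps (\<lambda>n. if n = 0 then 1 else (of_nat CARD('a) - 1) * of_nat CARD('a) ^ (n - 1)) :: rat fps)"
    by (intro fps_ext) (simp add: card_monics of_nat_diff)
  moreover have "1 + fps_const (of_nat CARD('a) - 1 - of_nat CARD('a)) * fps_X = (1 - fps_X :: rat fps)"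
    by (simp add: fps_const_neg[symmetric] del: fps_const_neg)
  ultimately show ?thesis
    using geometric_fps_mult[of "of_nat CARD('a) - 1 :: rat" "of_nat CARD('a)"]
    by (simp only: fps_of_nat)
qed

lemma field_involution_id: "field_involution (\<lambda>a. a)"
  by standard auto

lemma field_involution_frobenius:
  assumes "primepow q" "CARD('a::finite_field) = q ^ 2"
  shows "field_involution (\<lambda>a :: 'a. a ^ q)"
proof
  fix a b :: 'a
  obtain k where "q = CHAR('a) ^ k" using finite_field_card_primepow[OF assms] ..
  then show "(a + b) ^ q = a ^ q + b ^ q" by (intro freshmans_dream') simp_all
  show "(a * b) ^ q = a ^ q * b ^ q" by (rule power_mult_distrib)
  show "(a ^ q) ^ q = a"
    using finite_field_power_card_eq_same[of a] assms(2)
    by (simp add: power_mult[symmetric] power2_eq_square)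
qed

text \<open>There are q + 1 constant terms of norm 1, and for each of them a middle coefficient has
  q choices, the square root of the size of the field. So the parity of the degree disappears, and
  degree n > 0 has (q + 1) q^(n-1) self-dual polynomials.\<close>

lemma (in field_involution) frobenius_self_dual_series:
  assumes "\<phi> = (\<lambda>a. a ^ q)" "q > 1" "CARD('a) = q ^ 2"
  shows "Abs_fps (\<lambda>n. of_nat (card {f \<in> monics n. dual f = f})) * (1 - of_nat q * fps_X) =
           (1 + fps_X :: rat fps)"
proof -
  have mult: "(q + 1) * (q - 1) = CARD('a) - 1" "(q - 1) * (q + 1) = CARD('a) - 1"
    using assms(2,3) by (simp_all add: algebra_simps power2_eq_square diff_mult_distrib)
  have norm_one: "card {c. c * \<phi> c = 1} = q + 1"
    using card_power_eq[OF mult(1), of 1] by (simp add: assms(1))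
  have fixed: "card {a. c * \<phi> a = a} = q" if c: "c * \<phi> c = 1" for c
  proof -
    have c0: "c \<noteq> 0" using c by auto
    have "c ^ (q + 1) = 1" using c by (simp add: assms(1))
    \<comment> \<open>A nonzero a with c a^q = a is a solution of a^(q-1) = 1/c. Norm 1 is the
      solvability condition, and it gives q - 1 solutions; zero is the remaining one.\<close>
    then have "inverse c ^ (q + 1) = 1" by (metis inverse_1 power_inverse)
    then have "card {x. x ^ (q - 1) = inverse c} = q - 1"
      using card_power_eq[OF mult(2), of "inverse c"] assms(2) by simp
    moreover have "{a. c * \<phi> a = a} = insert 0 {x. x ^ (q - 1) = inverse c}"
    proof -
      have "c * \<phi> a = a \<longleftrightarrow> a = 0 \<or> a ^ (q - 1) = inverse c" for a
      proof -
        have "\<phi> a = a * a ^ (q - 1)"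
          using assms(1,2) by (simp flip: power_Suc)
        then show ?thesis using c0 by (auto simp: field_simps)
      qed
      then show ?thesis by auto
    qed
    moreover have "0 \<notin> {x. x ^ (q - 1) = inverse c}"
      using c0 assms(2) by (auto simp: power_0_left)
    ultimately show ?thesis using assms(2) by simp
  qed
  have card: "card {f \<in> monics n. dual f = f} = (if n = 0 then 1 else (q + 1) * q ^ (n - 1))" for n
  proof (cases n)
    case 0
    have "{f \<in> monics 0. dual f = f} = {1}" by (auto simp: monics_0)
    with 0 show ?thesis by simp
  next
    case (Suc k)
    have "card {f \<in> monics n. dual f = f} =
        (\<Sum>c | c * \<phi> c = 1. (q ^ 2) ^ (k div 2) * (if even k then 1 else q))"
      unfolding Suc card_self_dual assms(3) using fixed by (intro sum.cong) auto
    also have "\<dots> = (q + 1) * ((q ^ 2) ^ (k div 2) * (if even k then 1 else q))"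
      using norm_one by simp
    also have "(q ^ 2) ^ (k div 2) * (if even k then 1 else q) = q ^ k"
      by (auto simp: power_mult[symmetric] elim!: evenE oddE)
    finally show ?thesis using Suc by simp
  qed
  have "Abs_fps (\<lambda>n. of_nat (card {f \<in> monics n. dual f = f})) =
      (Abs_fps (\<lambda>n. if n = 0 then 1 else (of_nat q + 1) * of_nat q ^ (n - 1)) :: rat fps)"
    by (intro fps_ext) (simp add: card algebra_simps)
  moreover have "1 + fps_const (of_nat q + 1 - of_nat q) * fps_X = (1 + fps_X :: rat fps)"
    by simp
  ultimately show ?thesis
    using geometric_fps_mult[of "of_nat q + 1 :: rat" "of_nat q"]
    by (simp only: fps_of_nat)
qed

text \<open>The constant term is 1 or -1. For -1 in odd characteristic a middle coefficient
  satisfies -a = a and vanishes; in characteristic 2 both constant terms coincide. This produces the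
  two exponents.\<close>

lemma (in field_involution) id_self_dual_series:
  assumes "\<phi> = (\<lambda>a. a)"
  shows "Abs_fps (\<lambda>n. of_nat (card {f \<in> monics n. dual f = f})) * (1 - of_nat CARD('a) * fps_X ^ 2) =
           ((1 + fps_X) ^ (if (1 :: 'a) = -1 then 1 else 2) :: rat fps)"
proof -
  define Q where "Q = CARD('a)"
  define s where "s n = card {f \<in> monics n. dual f = f}" for n
  define S :: "rat fps" where "S = Abs_fps (\<lambda>n. of_nat (s n))"
  have s0: "s 0 = 1"
  proof -
    have "{f \<in> monics 0. dual f = f} = {1}" by (auto simp: monics_0)
    then show ?thesis by (simp add: s_def)
  qed
  have id: "\<phi> a = a" for a by (simp add: assms)
  have roots: "{c. c * \<phi> c = 1} = {1, -1}"
    using square_eq_1_iff by (auto simp: id)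
  have s_Suc: "s (Suc n) = Q ^ (n div 2) * (if even n then 1 else Q) +
      (if (1 :: 'a) = -1 then 0 else Q ^ (n div 2))" for n
  proof (cases "(1 :: 'a) = -1")
    case True
    then have "{c. c * \<phi> c = 1} = {1}" using roots by simp
    then show ?thesis using True by (simp add: s_def card_self_dual Q_def id)
  next
    case False
    then have "(2 :: 'a) \<noteq> 0" by (simp add: eq_neg_iff_add_eq_0)
    moreover have "- a = a \<longleftrightarrow> 2 * a = 0" for a :: 'a
      by (simp only: neg_eq_iff_add_eq_0 mult_2)
    ultimately have "{a. - a = a} = {0 :: 'a}" by auto
    then have "card {a :: 'a. - 1 * \<phi> a = a} = 1" by (simp add: id)
    moreover have "card {a :: 'a. 1 * \<phi> a = a} = Q" by (simp add: id Q_def)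
    moreover have "sum h {1, -1 :: 'a} = h 1 + h (-1)" for h :: "'a \<Rightarrow> nat" using False by simp
    ultimately show ?thesis using False unfolding s_def card_self_dual roots
      by (simp only: Q_def if_False mult_1_right if_cancel)
  qed
  \<comment> \<open>Two more degrees add one free coefficient. The recurrence does not start from
    degree 0, so degrees 0, 1 and 2 supply the numerator.\<close>
  have step: "s (Suc (Suc (Suc n))) = Q * s (Suc n)" for n
    by (simp add: s_Suc algebra_simps)
  have "S * (1 - of_nat Q * fps_X ^ 2) = S - fps_const (of_nat Q) * (fps_X ^ 2 * S)"
    by (simp add: algebra_simps fps_of_nat)
  also have "\<dots> = (1 + fps_X) ^ (if (1 :: 'a) = -1 then 1 else 2)"
  proof (rule fps_ext)
    fix n
    have rhs: "(1 + fps_X :: rat fps) ^ e $ n = of_nat (e choose n)" for e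
      by (simp flip: fps_binomial_of_nat binomial_gbinomial)
    have lhs: "(S - fps_const (of_nat Q) * (fps_X ^ 2 * S)) $ n =
        of_nat (s n) - of_nat Q * (if n < 2 then 0 else of_nat (s (n - 2)))"
      by (simp only: S_def fps_sub_nth fps_mult_left_const_nth fps_X_power_mult_nth fps_nth_Abs_fps)
    consider "n = 0" | "n = 1" | "n = 2" | m where "n = Suc (Suc (Suc m))"
      by (metis One_nat_def Suc_1 not0_implies_Suc)
    then show "(S - fps_const (of_nat Q) * (fps_X ^ 2 * S)) $ n =
        ((1 + fps_X) ^ (if (1 :: 'a) = -1 then 1 else 2)) $ n"
      unfolding lhs rhs
    proof cases
      case 2
      then show "of_nat (s n) - of_nat Q * (if n < 2 then 0 else of_nat (s (n - 2))) =
          (of_nat ((if (1 :: 'a) = -1 then 1 else 2) choose n) :: rat)"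
        using s_Suc[of 0] by simp
    next
      case 3
      then show "of_nat (s n) - of_nat Q * (if n < 2 then 0 else of_nat (s (n - 2))) =
          (of_nat ((if (1 :: 'a) = -1 then 1 else 2) choose n) :: rat)"
        using s_Suc[of 1] s0 by (simp add: numeral_2_eq_2)
    qed (auto simp: s0 step)
  qed
  finally show ?thesis by (simp add: S_def s_def Q_def)
qed

section \<open>Fixed irreducibles for the trivial conjugation\<close>

lemma linear_in_irred_monics:
  fixes x :: "'a::field"
  assumes "x \<noteq> 0"
  shows "[:-x, 1:] \<in> irred_monics"
  using assms by (simp add: irred_monics_def irreducible_linear_field_poly)

lemma irred_monics_root:
  fixes p :: "'a::field poly"
  assumes "p \<in> irred_monics" "poly p x = 0"
  shows "p = [:-x, 1:]"
proof -
  have "x \<noteq> 0" using assms(2) irred_monicsD(3)[OF assms(1)] by (auto simp: poly_0_coeff_0)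
  moreover have "[:-x, 1:] dvd p" using assms(2) by (simp add: poly_eq_0_iff_dvd)
  ultimately show ?thesis
    using monic_irreducible_dvd_imp_eq[OF linear_in_irred_monics assms(1)] by metis
qed

text \<open>Terms i and deg p - i have opposite signs at -1 and cancel in pairs. Pairing works in
  characteristic 2 as well, where p(-1) = -p(-1) would say nothing.\<close>

lemma palindromic_odd_root:
  fixes p :: "'a::comm_ring_1 poly"
  assumes "odd (degree p)" "\<And>i. i \<le> degree p \<Longrightarrow> coeff p (degree p - i) = coeff p i"
  shows "poly p (-1) = 0"
proof -
  obtain k where k: "degree p = 2 * k + 1" using assms(1) by (rule oddE)
  define b where "b i = coeff p i * (-1) ^ i" for i
  have b: "b (2 * k + 1 - i) = - b i" if "i \<le> 2 * k + 1" for i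
  proof -
    have "(-1 :: 'a) ^ (2 * k + 1 - i) = - ((-1) ^ i)"
    proof (cases "even i")
      case True
      then show ?thesis using that by simp
    next
      case False
      then show ?thesis using that by simp
    qed
    then show ?thesis using assms(2)[of i] that by (simp add: b_def k)
  qed
  have "{..2 * k + 1} = {..k} \<union> {k + 1..2 * k + 1}" by auto
  then have "poly p (-1) = (\<Sum>i\<in>{..k} \<union> {k + 1..2 * k + 1}. b i)"
    by (simp add: poly_altdef k b_def)
  also have "\<dots> = (\<Sum>i\<le>k. b i) + (\<Sum>i=k + 1..2 * k + 1. b i)"
    by (intro sum.union_disjoint) auto
  also have "(\<Sum>i=k + 1..2 * k + 1. b i) = (\<Sum>i\<le>k. - b i)"
    by (rule sum.reindex_bij_witness[of _ "\<lambda>i. 2 * k + 1 - i" "\<lambda>i. 2 * k + 1 - i"])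
       (auto simp: b[simplified])
  finally show ?thesis by (simp add: sum_negf)
qed

context field_involution
begin

context
  assumes id: "\<And>a. \<phi> a = a"
begin

lemma dual_id: "dual f = smult (inverse (coeff f 0)) (reflect_poly f)"
proof -
  have "map_poly \<phi> f = f" by (rule poly_eqI) (simp add: coeff_map_poly id)
  then show ?thesis by (simp add: dual_def id)
qed

text \<open>Comparing constant terms gives c^2 = 1. If c = -1 differs from 1, evaluating
  \<open>dual p = p\<close> at 1 gives p(1) = -p(1), and 2 is invertible.\<close>

lemma fixed_const_coeff:
  assumes "p \<in> irred_monics" "dual p = p"
  shows "coeff p 0 = 1 \<or> coeff p 0 = -1 \<and> poly p 1 = 0"
proof -
  note p = irred_monicsD[OF assms(1)]
  define c where "c = coeff p 0"
  have "coeff (dual p) 0 = inverse c" using p by (simp add: dual_id c_def)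
  then have "c * c = 1" using assms(2) p by (simp add: c_def field_simps)
  then have c: "c = 1 \<or> c = -1" by (simp add: square_eq_1_iff)
  moreover have "poly p 1 = 0" if "c = -1" "c \<noteq> 1"
  proof -
    have "poly (dual p) 1 = - poly p 1"
      unfolding dual_id c_def[symmetric] that(1) by (simp add: poly_reflect_poly_nz)
    then have "poly p 1 = - poly p 1" unfolding assms(2) .
    then have "poly p 1 + poly p 1 = 0" by (rule eq_neg_iff_add_eq_0 [THEN iffD1])
    then have "2 * poly p 1 = 0" by (simp only: mult_2)
    moreover have "(2 :: 'a) \<noteq> 0"
    proof -
      have "(1 :: 'a) \<noteq> -1" using that by metis
      then show ?thesis by (simp add: eq_neg_iff_add_eq_0)
    qed
    ultimately show ?thesis by simp
  qed
  ultimately show ?thesis by (auto simp: c_def)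
qed

text \<open>Constant term -1 would give the root 1 and hence p = x - 1, contradicting even degree.
  So the constant term is 1 and the normalised dual is plain reversal.\<close>

lemma fixed_even_degree_iff:
  assumes "d > 0" "degree p = 2 * d"
  shows "p \<in> irred_monics \<and> dual p = p \<longleftrightarrow>
           lead_coeff p = 1 \<and> irreducible p \<and> self_reciprocal p"
proof
  assume p: "p \<in> irred_monics \<and> dual p = p"
  have "poly p 1 \<noteq> 0"
    using irred_monics_root[of p 1] p assms by auto
  then have "coeff p 0 = 1" using fixed_const_coeff p by blast
  then have "reflect_poly p = p" using p by (simp add: dual_id)
  with p show "lead_coeff p = 1 \<and> irreducible p \<and> self_reciprocal p"
    by (auto simp: self_reciprocal_def irred_monics_def)
next
  assume p: "lead_coeff p = 1 \<and> irreducible p \<and> self_reciprocal p"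
  then have "coeff (reflect_poly p) 0 = coeff p 0" by (simp add: self_reciprocal_def)
  with p have "coeff p 0 = 1" by simp
  with p show "p \<in> irred_monics \<and> dual p = p"
    by (auto simp: self_reciprocal_def irred_monics_def dual_id)
qed

lemma fixed_irreds_even: "d > 0 \<Longrightarrow> fixed_irreds (2 * d) = SRIM_minus TYPE('a) d"
  using fixed_even_degree_iff[of d] unfolding fixed_irreds_def SRIM_minus_def
  by (intro arg_cong[of _ _ card]) blast

lemma fixed_odd_degree:
  assumes p: "p \<in> irred_monics" "dual p = p" and odd: "odd (degree p)"
  shows "p \<in> {[:1, 1:], [:-1, 1:]}"
  using fixed_const_coeff[OF p]
proof
  assume c: "coeff p 0 = 1"
  then have "reflect_poly p = p" using p by (simp add: dual_id)
  then have "coeff p (degree p - i) = coeff p i" if "i \<le> degree p" for i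
    using that coeff_reflect_poly[of p i] by simp
  then have "poly p (-1) = 0" using odd by (intro palindromic_odd_root)
  then show ?thesis using irred_monics_root[OF p(1), of "-1"] by simp
next
  assume "coeff p 0 = -1 \<and> poly p 1 = 0"
  then show ?thesis using irred_monics_root[OF p(1), of 1] by simp
qed

text \<open>The polynomials x + 1 and x - 1 coincide exactly in characteristic 2, so this number
  equals the exponent of 1 + X in the series of self-dual polynomials.\<close>

lemma fixed_irreds_1: "fixed_irreds 1 = (if (1 :: 'a) = -1 then 1 else 2)"
proof -
  have "dual [:c, 1:] = [:c, 1:]" if "c * c = 1" for c
  proof -
    have "c \<noteq> 0" "inverse c = c" using that by (auto intro: inverse_unique)
    then show ?thesis using that by (simp add: dual_id reflect_poly_def)
  qed
  moreover have "[:1, 1 :: 'a:] \<in> irred_monics" "[:-1, 1 :: 'a:] \<in> irred_monics"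
    using linear_in_irred_monics[of "-1 :: 'a"] linear_in_irred_monics[of "1 :: 'a"]
    by simp_all
  moreover have "p \<in> {[:1, 1:], [:-1, 1:]}" if "p \<in> irred_monics" "degree p = 1" "dual p = p" for p
    using fixed_odd_degree[of p] that by simp
  ultimately have "{p \<in> irred_monics. degree p = 1 \<and> dual p = p} = {[:1, 1:], [:-1, 1:]}"
    by auto
  then have eq: "fixed_irreds 1 = card {[:1, 1 :: 'a:], [:-1, 1:]}" by (simp only: fixed_irreds_def)
  show ?thesis
  proof (cases "(1 :: 'a) = -1")
    case True
    then have "[:-1, 1 :: 'a:] = [:1, 1:]" by (simp only: True [symmetric])
    with eq True show ?thesis by (simp only: insert_absorb2) simp
  next
    case False
    with eq show ?thesis by (simp add: card_insert_if)
  qed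
qed

lemma fixed_irreds_odd:
  assumes "d > 0"
  shows "fixed_irreds (2 * d + 1) = 0"
proof -
  have "degree p \<noteq> 2 * d + 1" if "p \<in> irred_monics" "dual p = p" for p
    using fixed_odd_degree[OF that] assms by auto
  then have "{p \<in> irred_monics. degree p = 2 * d + 1 \<and> dual p = p} = {}" by blast
  then show ?thesis by (simp only: fixed_irreds_def card.empty)
qed

end

end

section \<open>The generating function identities\<close>

lemma odd_card_iff:
  assumes "primepow q" "CARD('a::finite_field) = q"
  shows "odd q \<longleftrightarrow> (1 :: 'a) \<noteq> -1"
proof -
  obtain k where k: "q = CHAR('a) ^ k"
    using finite_field_card_primepow[OF assms(1), of 1, where 'a = 'a] assms(2) by auto
  have "k > 0" using k assms(1) by (auto intro: Nat.gr0I)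
  have "(1 :: 'a) = -1 \<longleftrightarrow> of_nat 2 = (0 :: 'a)" by (simp add: eq_neg_iff_add_eq_0)
  also have "\<dots> \<longleftrightarrow> CHAR('a) dvd 2" by (rule of_nat_eq_0_iff_char_dvd)
  also have "\<dots> \<longleftrightarrow> 2 dvd CHAR('a)"
  proof -
    have "prime CHAR('a)" by simp
    then show ?thesis using two_is_prime_nat by (metis dvd_refl primes_dvd_imp_eq)
  qed
  also have "\<dots> \<longleftrightarrow> even q" using k \<open>k > 0\<close> by simp
  finally show ?thesis by blast
qed

lemma fps_divide_mult_self:
  fixes f g :: "'a::field fps"
  assumes "g $ 0 \<noteq> 0"
  shows "f / g * g = f"
proof (rule dvd_div_mult_self, rule unit_imp_dvd)
  show "is_unit g" using assms by simp
qed

lemma monics_series_compose: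
  "(Abs_fps (\<lambda>n. of_nat (card (monics n :: 'a::finite_field poly set))) oo fps_X ^ 2) *
     (1 - of_nat CARD('a) * fps_X ^ 2) = (1 - fps_X ^ 2 :: rat fps)"
proof -
  have "(Abs_fps (\<lambda>n. of_nat (card (monics n :: 'a poly set))) * (1 - of_nat CARD('a) * fps_X)) oo
      fps_X ^ 2 = (1 - fps_X oo fps_X ^ 2 :: rat fps)"
    by (simp only: monics_series)
  moreover have "(1 - of_nat CARD('a) * fps_X) oo fps_X ^ 2 =
      (1 - of_nat CARD('a) * fps_X ^ 2 :: rat fps)"
    unfolding fps_of_nat[symmetric]
    by (simp add: fps_compose_sub_distrib fps_compose_mult_distrib del: fps_of_nat)
  ultimately show ?thesis
    by (simp add: fps_compose_mult_distrib fps_compose_sub_distrib)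
qed

text \<open>All fractions are given by cleared denominators, so the identity becomes ring algebra
  followed by cancelling the nonzero \<open>K\<close>. Here \<open>T\<close> is to be the series of
  all monics already taken at x^2.\<close>

lemma frobenius_series_identity:
  fixes x a T S R :: "'a::idom"
  assumes T: "T * (1 - a\<^sup>2 * x\<^sup>2) = 1 - x\<^sup>2" and S: "S * (1 - a * x) = 1 + x"
    and R: "R * ((1 - x) * (1 - a * x)) = (1 + x) * (1 + a * x)"
    and nz: "1 - x \<noteq> 0" "1 - a * x \<noteq> 0" "1 + a * x \<noteq> 0"
  shows "T * R = S\<^sup>2"
proof -
  define K where "K = (1 - a\<^sup>2 * x\<^sup>2) * ((1 - x) * (1 - a * x))"
  have sq: "1 - a\<^sup>2 * x\<^sup>2 = (1 - a * x) * (1 + a * x)" "1 - x\<^sup>2 = (1 - x) * (1 + x)"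
    by (simp_all add: algebra_simps power2_eq_square)
  have "(T * R) * K = (T * (1 - a\<^sup>2 * x\<^sup>2)) * (R * ((1 - x) * (1 - a * x)))"
    unfolding K_def by (simp only: mult_ac)
  also have "\<dots> = (1 - x\<^sup>2) * ((1 + x) * (1 + a * x))"
    by (simp only: T R)
  also have "\<dots> = (S * (1 - a * x)) * (S * (1 - a * x)) * ((1 - x) * (1 + a * x))"
    unfolding S sq by (simp only: mult_ac)
  also have "\<dots> = S\<^sup>2 * K"
    unfolding K_def sq power2_eq_square[of S] by (simp only: mult_ac)
  finally show ?thesis using nz by (simp add: K_def sq)
qed

text \<open>Here \<open>T\<close> and \<open>R\<close> are series in x^2, and \<open>h\<close> is
  the factor (1 + x)/(1 - x) of a single linear fixed irreducible. There are e + 1 of these, with e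
  = 1 for odd and e = 0 for even q.\<close>

lemma reciprocal_series_identity:
  fixes x a T S R h :: "'a::idom"
  assumes T: "T * (1 - a * x\<^sup>2) = 1 - x\<^sup>2" and S: "S * (1 - a * x\<^sup>2) = (1 + x) ^ Suc e"
    and R: "R * (1 - a * x\<^sup>2) = (1 - x\<^sup>2) ^ e" and h: "h * (1 - x) = 1 + x"
    and nz: "1 - x \<noteq> 0" "1 - a * x\<^sup>2 \<noteq> 0"
  shows "T * (h ^ Suc e * R) = S\<^sup>2"
proof -
  define K where "K = (1 - a * x\<^sup>2) * (1 - a * x\<^sup>2) * (1 - x) ^ Suc e"
  have sq: "1 - x\<^sup>2 = (1 - x) * (1 + x)"
    by (simp add: algebra_simps power2_eq_square)
  have "(T * (h ^ Suc e * R)) * K =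
      (T * (1 - a * x\<^sup>2)) * (R * (1 - a * x\<^sup>2)) * (h ^ Suc e * (1 - x) ^ Suc e)"
    unfolding K_def by (simp only: mult_ac)
  also have "\<dots> = (1 - x\<^sup>2) ^ Suc e * (1 + x) ^ Suc e"
    unfolding T R power_mult_distrib[symmetric, of h] h by (simp only: power_Suc)
  also have "\<dots> = (S * (1 - a * x\<^sup>2)) * (S * (1 - a * x\<^sup>2)) * (1 - x) ^ Suc e"
    unfolding sq S power_mult_distrib by (simp only: mult_ac)
  also have "\<dots> = S\<^sup>2 * K"
    unfolding K_def power2_eq_square[of S] by (simp only: mult_ac)
  finally show ?thesis using nz by (simp add: K_def)
qed

lemma SDIM_partition_series:
  assumes q: "primepow q" and card: "CARD('K::finite_field) = q ^ 2" and \<epsilon>: "\<epsilon> \<in> {-1, 1}"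
  shows "partition_series \<epsilon> (SDIM_minus TYPE('K) q) =
    ((1 + fps_X) * (1 + of_nat q * fps_X) / ((1 - fps_X) * (1 - of_nat q * fps_X))) powi \<epsilon>"
proof (rule partition_series_eqI[OF \<epsilon>])
  interpret field_involution "\<lambda>a :: 'K. a ^ q"
    using q card by (rule field_involution_frobenius)
  define T :: "rat fps" where "T = Abs_fps (\<lambda>n. of_nat (card (monics n :: 'K poly set)))"
  define S :: "rat fps" where "S = Abs_fps (\<lambda>n. of_nat (card {f \<in> monics n. dual f = f}))"
  define R :: "rat fps"
    where "R = (1 + fps_X) * (1 + of_nat q * fps_X) / ((1 - fps_X) * (1 - of_nat q * fps_X))"
  have nz: "1 - fps_X \<noteq> (0 :: rat fps)" "1 - of_nat q * fps_X \<noteq> (0 :: rat fps)"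
    "1 + of_nat q * fps_X \<noteq> (0 :: rat fps)"
    by (auto dest: arg_cong[of _ _ "\<lambda>f. f $ 0"])
  have "(T oo fps_X ^ 2) * (1 - (of_nat q)\<^sup>2 * fps_X\<^sup>2) = 1 - fps_X\<^sup>2"
    using monics_series_compose[where 'a = 'K] by (simp only: card T_def of_nat_power)
  moreover have "S * (1 - of_nat q * fps_X) = 1 + fps_X"
    unfolding S_def using primepow_gt_Suc_0[OF q] card
    by (intro frobenius_self_dual_series) simp_all
  moreover have "R * ((1 - fps_X) * (1 - of_nat q * fps_X)) = (1 + fps_X) * (1 + of_nat q * fps_X)"
    unfolding R_def by (rule fps_divide_mult_self) simp
  ultimately have TR: "(T oo fps_X ^ 2) * R = S\<^sup>2"
    using nz by (rule frobenius_series_identity)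
  have N: "fixed_irreds d = SDIM_minus TYPE('K) q d" for d
    unfolding fixed_irreds_def SDIM_minus_def
    by (intro arg_cong[of _ _ card])
       (auto simp: irred_monics_def self_dual_def dual_def dual_poly_def conj_poly_def)
  fix m n :: nat assume "n \<le> m"
  have "(T oo fps_X ^ 2) $ 0 \<noteq> 0" by (simp add: T_def monics_0)
  then show "(\<Prod>d=1..m. ((1 + fps_X ^ d) * inverse (1 - fps_X ^ d)) ^ SDIM_minus TYPE('K) q d) $ n =
      R $ n"
  proof (rule fps_mult_nth_cancel)
    fix i assume "i \<le> n"
    with \<open>n \<le> m\<close> have "i \<le> m" by simp
    from euler_product_fixed_irreds[OF this]
    show "((T oo fps_X ^ 2) * (\<Prod>d=1..m. ((1 + fps_X ^ d) * inverse (1 - fps_X ^ d)) ^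
        SDIM_minus TYPE('K) q d)) $ i = ((T oo fps_X ^ 2) * R) $ i"
      by (simp only: N TR flip: T_def S_def)
  qed
qed

lemma SRIM_partition_series:
  assumes q: "primepow q" and card: "CARD('k::finite_field) = q" and \<epsilon>: "\<epsilon> \<in> {-1, 1}"
  shows "partition_series \<epsilon> (SRIM_minus TYPE('k)) =
    (if odd q then ((1 - fps_X) / (1 - of_nat q * fps_X)) powi \<epsilon>
     else (1 / (1 - of_nat q * fps_X)) powi \<epsilon>)"
  unfolding if_distrib[of "\<lambda>f. f powi \<epsilon>", symmetric]
proof (rule partition_series_eqI[OF \<epsilon>])
  interpret field_involution "\<lambda>a :: 'k. a" by (rule field_involution_id)
  define e :: nat where "e = (if odd q then 1 else 0)"
  define T :: "rat fps" where "T = Abs_fps (\<lambda>n. of_nat (card (monics n :: 'k poly set)))"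
  define S :: "rat fps" where "S = Abs_fps (\<lambda>n. of_nat (card {f \<in> monics n. dual f = f}))"
  define R :: "rat fps"
    where "R = (if odd q then (1 - fps_X) / (1 - of_nat q * fps_X) else 1 / (1 - of_nat q * fps_X))"
  define g :: "nat \<Rightarrow> rat fps" where "g d = (1 + fps_X ^ d) * inverse (1 - fps_X ^ d)" for d
  define P where "P m = (\<Prod>d=1..m. g d ^ SRIM_minus TYPE('k) d)" for m
  have char2_iff: "(1 :: 'k) = -1 \<longleftrightarrow> even q" using odd_card_iff[OF q card] by blast
  have e_Suc: "(if (1 :: 'k) = -1 then 1 else 2) = Suc e" unfolding char2_iff e_def by simp
  have nz: "1 - fps_X \<noteq> (0 :: rat fps)" "1 - of_nat q * fps_X\<^sup>2 \<noteq> (0 :: rat fps)"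
    by (auto dest: arg_cong[of _ _ "\<lambda>f. f $ 0"])
  have T: "(T oo fps_X ^ 2) * (1 - of_nat q * fps_X\<^sup>2) = 1 - fps_X\<^sup>2"
    using monics_series_compose[where 'a = 'k] by (simp only: card T_def)
  have S: "S * (1 - of_nat q * fps_X\<^sup>2) = (1 + fps_X) ^ Suc e"
    using id_self_dual_series by (simp only: e_Suc S_def card)
  have "R = (1 - fps_X) ^ e / (1 - of_nat q * fps_X)" by (simp add: R_def e_def)
  then have "R * (1 - of_nat q * fps_X) = (1 - fps_X) ^ e"
    by (simp only:) (rule fps_divide_mult_self, simp)
  then have "(R * (1 - of_nat q * fps_X)) oo fps_X\<^sup>2 = (1 - fps_X) ^ e oo fps_X\<^sup>2"
    by (rule arg_cong)
  moreover have "(1 - of_nat q * fps_X) oo fps_X ^ 2 = (1 - of_nat q * fps_X ^ 2 :: rat fps)"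
    unfolding fps_of_nat[symmetric]
    by (simp add: fps_compose_sub_distrib fps_compose_mult_distrib del: fps_of_nat)
  ultimately have R: "(R oo fps_X\<^sup>2) * (1 - of_nat q * fps_X\<^sup>2) = (1 - fps_X\<^sup>2) ^ e"
    by (simp add: fps_compose_mult_distrib fps_compose_sub_distrib flip: fps_compose_power)
  have h: "g 1 * (1 - fps_X) = 1 + fps_X"
    using inverse_mult_eq_1[of "1 - fps_X :: rat fps"] by (simp add: g_def mult.assoc)
  have TR: "(T oo fps_X ^ 2) * (g 1 ^ Suc e * (R oo fps_X\<^sup>2)) = S\<^sup>2"
    using T S R h nz by (rule reciprocal_series_identity)
  have g_compose: "g d oo fps_X\<^sup>2 = g (2 * d)" if "d > 0" for d
    using that by (simp add: g_def fps_compose_mult_distrib fps_compose_add_distrib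
        fps_compose_sub_distrib fps_inverse_compose fps_X_power_compose power_mult)
  \<comment> \<open>Each step of the induction adds an even degree, which supplies the new factor of
    \<open>P\<close>, and an odd degree above 1, which supplies nothing.\<close>
  have prod: "(\<Prod>d=1..2 * m + 1. g d ^ fixed_irreds d) = g 1 ^ Suc e * (P m oo fps_X\<^sup>2)" for m
  proof (induction m)
    case 0
    then show ?case using fixed_irreds_1 by (simp only: P_def e_Suc) simp
  next
    case (Suc m)
    have "(\<Prod>d=1..2 * Suc m + 1. g d ^ fixed_irreds d) =
        (\<Prod>d=1..2 * m + 1. g d ^ fixed_irreds d) * g (2 * Suc m) ^ fixed_irreds (2 * Suc m) *
        g (2 * Suc m + 1) ^ fixed_irreds (2 * Suc m + 1)"
      by (simp add: mult.assoc)
    also have "\<dots> = g 1 ^ Suc e * (P m oo fps_X\<^sup>2) * (g (Suc m) oo fps_X\<^sup>2) ^ SRIM_minus TYPE('k) (Suc m)"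
      using Suc.IH fixed_irreds_even[of "Suc m"] fixed_irreds_odd[of "Suc m"] g_compose[of "Suc m"]
      by (simp only: zero_less_Suc power_0 mult_1_right)
    also have "\<dots> = g 1 ^ Suc e * (P (Suc m) oo fps_X\<^sup>2)"
      by (simp add: P_def fps_compose_mult_distrib fps_compose_power mult.assoc)
    finally show ?case .
  qed
  fix m n :: nat assume nm: "n \<le> m"
  \<comment> \<open>The linear factors are cancelled together with T(x^2). What remains are series
    in x^2, whose coefficient at 2 n is the coefficient of the original series at n.\<close>
  have "((T oo fps_X ^ 2) * g 1 ^ Suc e) $ 0 \<noteq> 0"
    by (simp add: T_def monics_0 g_def fps_nth_power_0)
  then have "(P m oo fps_X\<^sup>2) $ (2 * n) = (R oo fps_X\<^sup>2) $ (2 * n)"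
  proof (rule fps_mult_nth_cancel)
    fix i assume "i \<le> 2 * n"
    with nm have "i \<le> 2 * m + 1" by simp
    from euler_product_fixed_irreds[OF this]
    show "((T oo fps_X ^ 2) * g 1 ^ Suc e * (P m oo fps_X\<^sup>2)) $ i =
        ((T oo fps_X ^ 2) * g 1 ^ Suc e * (R oo fps_X\<^sup>2)) $ i"
      by (simp only: mult.assoc TR prod flip: T_def S_def g_def)
  qed
  then show "(\<Prod>d=1..m. ((1 + fps_X ^ d) * inverse (1 - fps_X ^ d)) ^ SRIM_minus TYPE('k) d) $ n = R $ n"
    by (simp add: compose_X_power_nth P_def g_def)
qed

theorem theorem6p8:
  fixes q :: nat and \<epsilon> :: int
  assumes "primepow q"
    and "CARD('k::finite_field) = q"
    and "CARD('K::finite_field) = q ^ 2"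
    and "\<epsilon> \<in> {-1, 1}"
  shows
    "Abs_fps (\<lambda>n. if n = 0 then 1 else
        (\<Sum>p\<in>partitions n. \<Prod>d\<in>distinct_parts p. \<Sum>i=1..part_mult p d.
           2 ^ i * sbinom (of_nat (part_mult p d) - 1) (\<epsilon> * (int (part_mult p d) - int i))
                 * sbinom (of_nat (SDIM_minus TYPE('K) q d)) (\<epsilon> * int i)))
     = (((1 + fps_X) * (1 + of_nat q * fps_X) / ((1 - fps_X) * (1 - of_nat q * fps_X)))
          :: rat fps) powi \<epsilon>
   \<and>
     Abs_fps (\<lambda>n. if n = 0 then 1 else
        (\<Sum>p\<in>partitions n. \<Prod>d\<in>distinct_parts p. \<Sum>i=1..part_mult p d.
           2 ^ i * sbinom (of_nat (part_mult p d) - 1) (\<epsilon> * (int (part_mult p d) - int i))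
                 * sbinom (of_nat (SRIM_minus TYPE('k) d)) (\<epsilon> * int i)))
     = (if odd q then ((1 - fps_X) / (1 - of_nat q * fps_X) :: rat fps) powi \<epsilon>
        else (1 / (1 - of_nat q * fps_X) :: rat fps) powi \<epsilon>)"
  using SDIM_partition_series[OF assms(1,3,4)] SRIM_partition_series[OF assms(1,2,4)]
  unfolding partition_series_def by (rule conjI)

end
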